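(* Let $-1<q\le1$, let $\rho_{12},\rho_{13},\rho_{23}\in(-1,1)$ satisfy $1+2\rho_{12}\rho_{13}\rho_{23}-\rho_{12}^2-\rho_{13}^2-\rho_{23}^2\ge0$, and let $x_1,x_2,x_3\in S(q)$. If $\rho_{12}=\rho_{13}\rho_{23}$, then i) $$f_{3D}(x_1,x_2,x_3|\rho_{13}\rho_{23},\rho_{13},\rho_{23},q)=f_{CN}(x_1|x_3,\rho_{13},q)\,f_{CN}(x_3|x_2,\rho_{23},q)\,f_N(x_2|q),$$ ii) $$\sum_{s\ge0}\frac{\rho_{13}^s}{[s]_q!\,(\rho_{13}^2\rho_{23}^2)_s}P_s(x_1|x_2,\rho_{13}\rho_{23},q)P_s(x_3|x_2,\rho_{23},q)=\frac{f_{CN}(x_1|x_3,\rho_{13},q)}{f_{CN}(x_1|x_2,\rho_{13}\rho_{23},q)}.$$ If $\rho_{12}=0$, then iii) $$\sum_{s=0}^\infty\frac{(-1)^sq^{\binom s2}\rho_{13}^s\rho_{23}^s}{[s]_q!\,(\rho_{13}^2,\rho_{23}^2)_s}P_s(x_1|x_3,\rho_{13},q)P_s(x_2|x_3,\rho_{23},q)=\frac{f_N(x_1|q)}{f_{CN}(x_1|x_3,\rho_{13},q)}\sum_{k\ge0}\frac{\rho_{13}^k}{[k]_q!\,(\rho_{23}^2)_k}H_k(x_1|q)P_k(x_3|x_2,\rho_{23},q).$$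
   Context: Notation, for $-1<q\le1$: $[0]_q=0$, $[n]_q=1+q+\dots+q^{n-1}$, $[n]_q!=\prod_{i=1}^n[i]_q$, $[0]_q!=1$; $(a)_n=\prod_{i=0}^{n-1}(1-aq^i)$, $(a)_0=1$, $(a,b)_n=(a)_n(b)_n$, and, for $|q|<1$, $(a)_\infty=\prod_{i\ge0}(1-aq^i)$; $S(q)=[-2/\sqrt{1-q},2/\sqrt{1-q}]$ for $|q|<1$, $S(1)=\mathbb R$. $q$-Hermite polynomials: $H_{-1}=0$, $H_0=1$, $H_{n+1}(x|q)=xH_n(x|q)-[n]_qH_{n-1}(x|q)$. Al-Salam–Chihara polynomials: $P_{-1}=0$, $P_0=1$, $P_{n+1}(x|y,\rho,q)=(x-\rho yq^n)P_n(x|y,\rho,q)-(1-\rho^2q^{n-1})[n]_qP_{n-1}(x|y,\rho,q)$, $n\ge0$. Densities, for $|q|<1$, $x,y\in S(q)$, $|\rho|<1$: $$f_N(x|q)=\frac{(q)_\infty\sqrt{1-q}}{2\pi}\sqrt{4-(1-q)x^2}\prod_{k=1}^\infty\big((1+q^k)^2-(1-q)x^2q^k\big),\qquad f_{CN}(x|y,\rho,q)=f_N(x|q)\,(\rho^2)_\infty\prod_{k=0}^\infty\frac1{v_0(x,y|\rho q^k,q)},$$ where $v_0(x,y|\rho,q)=(1-\rho^2)^2-(1-q)\rho(1+\rho^2)xy+(1-q)\rho^2(x^2+y^2)$. For $q=1$: $f_N(x|1)=\frac1{\sqrt{2\pi}}e^{-x^2/2}$, $f_{CN}(x|y,\rho,1)=\frac1{\sqrt{2\pi(1-\rho^2)}}\exp\left(-\frac{(x-\rho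 y)^2}{2(1-\rho^2)}\right)$. In ratios of these densities in the same variable $x$ the common factor $f_N(x|q)$ is cancelled, so they make sense also at the endpoints of $S(q)$. $$f_{3D}(x_1,x_2,x_3|\rho_{12},\rho_{13},\rho_{23},q)=\prod_{i=1}^3f_N(x_i|q)\sum_{i,j,k\ge0}\frac{\rho_{12}^j\rho_{23}^k\rho_{13}^i}{[i]_q![j]_q![k]_q!}H_{i+j}(x_1|q)H_{j+k}(x_2|q)H_{i+k}(x_3|q)$$ (the series is absolutely convergent for $|q|<1$; for $q=1$ it is the classical Kibble–Slepian expansion, and $f_{3D}$ is the density of the centered Gaussian distribution with unit variances and correlations $\rho_{12},\rho_{13},\rho_{23}$).
   Formalization: In iii), for q=1 only, the condition 1+2ρ12ρ13ρ23-ρ12²-ρ13²-ρ23²≥0 is required to be strict, because for q=1, ρ12=0 and equality both series diverge (e.g. ρ13=3/5, ρ23=4/5, all x_i=0). *)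

theory Defs
  imports "HOL-Probability.Probability"
begin

definition qint :: "nat \<Rightarrow> real \<Rightarrow> real" where
  "qint n q = (\<Sum>i<n. q ^ i)"

definition qfact :: "nat \<Rightarrow> real \<Rightarrow> real" where
  "qfact n q = (\<Prod>i=1..n. qint i q)"

definition qpoch :: "real \<Rightarrow> real \<Rightarrow> nat \<Rightarrow> real" where
  "qpoch a q n = (\<Prod>i<n. 1 - a * q ^ i)"

definition qpoch_inf :: "real \<Rightarrow> real \<Rightarrow> real" where
  "qpoch_inf a q = (\<Prod>i. 1 - a * q ^ i)"

definition Sq :: "real \<Rightarrow> real set" where
  "Sq q = (if q = 1 then UNIV else {- 2 / sqrt (1 - q) .. 2 / sqrt (1 - q)})"

text \<open>In both recurrences the terms with index \<open>-1\<close> vanish, so the first step is written out.\<close>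

fun qH :: "nat \<Rightarrow> real \<Rightarrow> real \<Rightarrow> real" where
  "qH 0 x q = 1"
| "qH (Suc 0) x q = x"
| "qH (Suc (Suc n)) x q = x * qH (Suc n) x q - qint (Suc n) q * qH n x q"

fun ASC :: "nat \<Rightarrow> real \<Rightarrow> real \<Rightarrow> real \<Rightarrow> real \<Rightarrow> real" where
  "ASC 0 x y \<rho> q = 1"
| "ASC (Suc 0) x y \<rho> q = x - \<rho> * y"
| "ASC (Suc (Suc n)) x y \<rho> q =
     (x - \<rho> * y * q ^ Suc n) * ASC (Suc n) x y \<rho> q
     - (1 - \<rho>\<^sup>2 * q ^ n) * qint (Suc n) q * ASC n x y \<rho> q"

definition v0 :: "real \<Rightarrow> real \<Rightarrow> real \<Rightarrow> real \<Rightarrow> real" where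
  "v0 x y \<rho> q = (1 - \<rho>\<^sup>2)\<^sup>2 - (1 - q) * \<rho> * (1 + \<rho>\<^sup>2) * x * y
                + (1 - q) * \<rho>\<^sup>2 * (x\<^sup>2 + y\<^sup>2)"

definition f_N :: "real \<Rightarrow> real \<Rightarrow> real" where
  "f_N x q =
     (if q = 1 then std_normal_density x
      else qpoch_inf q q * sqrt (1 - q) / (2 * pi) * sqrt (4 - (1 - q) * x\<^sup>2)
           * (\<Prod>k. (1 + q ^ Suc k)\<^sup>2 - (1 - q) * x\<^sup>2 * q ^ Suc k))"

text \<open>The quotient of \<open>f_CN\<close> (below) by \<open>f_N\<close> with the common factor \<open>f_N\<close> cancelled.
  Unlike the literal quotient, it is also meaningful at the endpoints of \<open>Sq q\<close>, where
  \<open>f_N\<close> and \<open>f_CN\<close> both vanish.\<close>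

definition f_CN_over_f_N :: "real \<Rightarrow> real \<Rightarrow> real \<Rightarrow> real \<Rightarrow> real" where
  "f_CN_over_f_N x y \<rho> q =
     (if q = 1 then normal_density (\<rho> * y) (sqrt (1 - \<rho>\<^sup>2)) x / std_normal_density x
      else qpoch_inf (\<rho>\<^sup>2) q * (\<Prod>k. 1 / v0 x y (\<rho> * q ^ k) q))"

definition f_CN :: "real \<Rightarrow> real \<Rightarrow> real \<Rightarrow> real \<Rightarrow> real" where
  "f_CN x y \<rho> q =
     (if q = 1 then normal_density (\<rho> * y) (sqrt (1 - \<rho>\<^sup>2)) x
      else f_N x q * qpoch_inf (\<rho>\<^sup>2) q * (\<Prod>k. 1 / v0 x y (\<rho> * q ^ k) q))"

text \<open>Quotients of densities in the same variable, with \<open>f_N x q\<close> cancelled.\<close>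

definition f_CN_ratio :: "real \<Rightarrow> real \<Rightarrow> real \<Rightarrow> real \<Rightarrow> real \<Rightarrow> real \<Rightarrow> real" where
  "f_CN_ratio x y \<rho> z \<sigma> q = f_CN_over_f_N x y \<rho> q / f_CN_over_f_N x z \<sigma> q"

definition f_N_over_f_CN :: "real \<Rightarrow> real \<Rightarrow> real \<Rightarrow> real \<Rightarrow> real" where
  "f_N_over_f_CN x y \<rho> q = 1 / f_CN_over_f_N x y \<rho> q"

lemma f_CN_eq: "f_CN x y \<rho> q = f_N x q * f_CN_over_f_N x y \<rho> q"
  by (simp add: f_CN_def f_CN_over_f_N_def f_N_def normal_density_def)

lemma f_N_nonzero:
  assumes q: "-1 < q" "q \<le> 1" and x: "x \<in> interior (Sq q)"
  shows "f_N x q \<noteq> 0"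
proof (cases "q = 1")
  case True
  then show ?thesis by (simp add: f_N_def normal_density_def)
next
  case False
  with q have q1: "\<bar>q\<bar> < 1" and pos: "0 < 1 - q" by auto
  from x False have "\<bar>x\<bar> < 2 / sqrt (1 - q)"
    by (auto simp: Sq_def interior_atLeastAtMost_real)
  then have "\<bar>x\<bar> * sqrt (1 - q) < 2"
    using pos by (simp add: field_simps)
  then have "(\<bar>x\<bar> * sqrt (1 - q))\<^sup>2 < 2\<^sup>2"
    using pos by (intro power_strict_mono) auto
  then have x4: "(1 - q) * x\<^sup>2 < 4"
    using pos by (simp add: power_mult_distrib mult.commute)
  have x0: "0 \<le> (1 - q) * x\<^sup>2" using pos by simp
  have sq: "summable (\<lambda>i. \<bar>q\<bar> ^ i)" using q1 by (simp add: summable_geometric)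
  have qk: "\<bar>q ^ Suc k\<bar> < 1" for k
    using q1 by (metis abs_ge_zero power_Suc_less_one power_abs power_less_one_iff zero_less_Suc)
  have "summable (\<lambda>i. norm ((1 - q * q ^ i) - 1))"
    using summable_mult[OF sq, of "\<bar>q\<bar>"] by (simp add: abs_mult power_abs)
  then have "convergent_prod (\<lambda>i. 1 - q * q ^ i)"
    by (intro abs_convergent_prod_imp_convergent_prod summable_imp_abs_convergent_prod)
  moreover have "1 - q * q ^ i \<noteq> 0" for i using qk[of i] by auto
  ultimately have p1: "qpoch_inf q q \<noteq> 0"
    unfolding qpoch_inf_def by (intro prodinf_nonzero) auto
  define c where "c = (1 - q) * x\<^sup>2"
  have c: "0 \<le> c" "c < 4" using x0 x4 by (simp_all add: c_def)
  define g where "g k = (1 + q ^ Suc k)\<^sup>2 - c * q ^ Suc k" for k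
  have g_pos: "g k > 0" for k
  proof -
    define t where "t = q ^ Suc k"
    have t: "\<bar>t\<bar> < 1" using qk[of k] by (simp add: t_def)
    have "(1 + t)\<^sup>2 - c * t > 0"
    proof (cases "t \<ge> 0")
      case True
      then have "c * t \<le> 4 * t" using c by (intro mult_right_mono) auto
      moreover have "(1 - t)\<^sup>2 > 0" using t by simp
      ultimately show ?thesis by (simp add: power2_eq_square algebra_simps)
    next
      case False
      then have "c * t \<le> 0" using c by (simp add: mult_nonneg_nonpos)
      moreover have "(1 + t)\<^sup>2 > 0" using t by simp
      ultimately show ?thesis by linarith
    qed
    then show ?thesis by (simp add: g_def t_def)
  qed
  have bound: "norm (norm (g k - 1)) \<le> 7 * \<bar>q\<bar> ^ k" for k
  proof -
    define t where "t = q ^ Suc k"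
    have t: "\<bar>t\<bar> < 1" using qk[of k] by (simp add: t_def)
    have "g k - 1 = t * (2 + t - c)"
      unfolding g_def t_def by (simp add: power2_eq_square algebra_simps)
    then have "\<bar>g k - 1\<bar> = \<bar>t\<bar> * \<bar>2 + t - c\<bar>" by (simp add: abs_mult)
    also have "\<dots> \<le> \<bar>t\<bar> * 7" using t c by (intro mult_left_mono) auto
    also have "\<bar>t\<bar> \<le> \<bar>q\<bar> ^ k"
      using q1 by (simp add: t_def abs_mult power_abs mult_left_le_one_le)
    finally show ?thesis by simp
  qed
  have "summable (\<lambda>k. norm (g k - 1))"
    by (rule summable_comparison_test'[OF summable_mult[OF sq, of 7]]) (rule bound)
  then have "convergent_prod g"
    by (intro abs_convergent_prod_imp_convergent_prod summable_imp_abs_convergent_prod)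
  then have p2: "(\<Prod>k. g k) \<noteq> 0"
    by (intro prodinf_nonzero) (use g_pos in \<open>auto simp: less_le\<close>)
  show ?thesis
    using p1 p2 False pos x4 by (simp add: f_N_def g_def[abs_def] c_def)
qed

lemma f_CN_ratio_eq:
  assumes "-1 < q" "q \<le> 1" "x \<in> interior (Sq q)"
  shows "f_CN_ratio x y \<rho> z \<sigma> q = f_CN x y \<rho> q / f_CN x z \<sigma> q"
  using f_N_nonzero[OF assms] by (simp add: f_CN_eq f_CN_ratio_def)

lemma f_N_over_f_CN_eq:
  assumes "-1 < q" "q \<le> 1" "x \<in> interior (Sq q)"
  shows "f_N_over_f_CN x y \<rho> q = f_N x q / f_CN x y \<rho> q"
  using f_N_nonzero[OF assms] by (simp add: f_CN_eq f_N_over_f_CN_def)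

definition corr_mat :: "real \<Rightarrow> real \<Rightarrow> real \<Rightarrow> real^3^3" where
  "corr_mat \<rho>12 \<rho>13 \<rho>23 =
     vector [vector [1, \<rho>12, \<rho>13], vector [\<rho>12, 1, \<rho>23], vector [\<rho>13, \<rho>23, 1]]"

text \<open>Density of the nondegenerate centered Gaussian distribution with covariance matrix \<open>R\<close>.\<close>

definition gauss3_density :: "real^3^3 \<Rightarrow> real^3 \<Rightarrow> real" where
  "gauss3_density R x = exp (- (x \<bullet> (matrix_inv R *v x)) / 2) / sqrt ((2 * pi) ^ 3 * det R)"

text \<open>For \<open>q = 1\<close> the triple series need not converge absolutely, so \<open>f_3D\<close> is the
  Gaussian density in that case.\<close>

definition f_3D :: "real \<Rightarrow> real \<Rightarrow> real \<Rightarrow> real \<Rightarrow> real \<Rightarrow> real \<Rightarrow> real \<Rightarrow> real" where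
  "f_3D x1 x2 x3 \<rho>12 \<rho>13 \<rho>23 q =
     (if q = 1 then gauss3_density (corr_mat \<rho>12 \<rho>13 \<rho>23) (vector [x1, x2, x3])
      else f_N x1 q * f_N x2 q * f_N x3 q *
        (\<Sum>\<^sub>\<infinity>(i, j, k)\<in>UNIV. \<rho>12 ^ j * \<rho>23 ^ k * \<rho>13 ^ i
            / (qfact i q * qfact j q * qfact k q)
            * qH (i + j) x1 q * qH (j + k) x2 q * qH (i + k) x3 q))"

end

theory Submission
  imports Defs "HOL-Real_Asymp.Real_Asymp"
begin

text \<open>
  The density quotients in the theorem are values, or quotients of values, of one power series. Write
  \<open>M(x, y; t) = \<Sum>\<^sub>m t\<^sup>m / [m]! H\<^sub>m(x) H\<^sub>m(y)\<close>. The \<open>q\<close>-Mehler formula says that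
  \<open>f_CN(x|y, t) = f_N(x) M(x, y; t)\<close>, also for \<open>q = 1\<close>. The engine is the shifted series
  \<open>A\<^sub>s(x, y; t) = \<Sum>\<^sub>m t\<^sup>m / [m]! H\<^bsub>m+s\<^esub>(x) H\<^sub>m(y)\<close>: the three-term recurrence of the \<open>q\<close>-Hermite
  polynomials turns termwise into the Al-Salam--Chihara recurrence in \<open>s\<close>, so
  \<open>A\<^sub>s(x, y; t) = M(x, y; t) P\<^sub>s(x|y, t) / (t\<^sup>2)\<^sub>s\<close> (\<open>shifted_mehler_eq\<close>). The cases \<open>s = 1, 2\<close>
  compute the \<open>q\<close>-derivative of \<open>M\<close> in \<open>t\<close> as \<open>M\<close> times a rational function. For \<open>|q| < 1\<close> this is a
  functional equation linking \<open>M(t)\<close> and \<open>M(qt)\<close>, whose iteration gives the infinite product; for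
  \<open>q = 1\<close> it is a differential equation solved by the Gaussian kernel (\<open>mehler_closed_form\<close>).

  Put \<open>x = x1\<close>, \<open>y = x2\<close>, \<open>z = x3\<close>. Each of the expansions ii) and iii) comes from summing a double series along rows and
  along diagonals. For ii), with \<open>t = \<rho>13\<close> and \<open>\<rho> = \<rho>23\<close>, insert
  \<open>H\<^sub>n(z) = \<Sum>\<^sub>s [n choose s] \<rho>\<^bsup>n-s\<^esup> H\<^bsub>n-s\<^esub>(y) P\<^sub>s(z|y, \<rho>)\<close> (\<open>qH_connection\<close>) into \<open>M(x, z; t)\<close>;
  for fixed \<open>s\<close> what remains is \<open>A\<^sub>s(x, y; t \<rho>)\<close>. For iii), with \<open>a = \<rho>13\<close> and \<open>b = \<rho>23\<close>, start from
  \<open>M(x, z; a)\<close> times the left-hand side, replace each \<open>M P\<^sub>s / (a\<^sup>2)\<^sub>s\<close> by the series \<open>A\<^sub>s(x, z; a)\<close>, and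
  collect the coefficient of \<open>a\<^sup>n H\<^sub>n(x)\<close>; it is a finite sum evaluated by
  \<open>ASC_inverse_connection\<close>. For i) with \<open>|q| < 1\<close>, expand \<open>H\<^sub>m(z) H\<^sub>n(z)\<close> in the product
  \<open>M(x, z; a) M(z, y; b)\<close> by the linearization formula (\<open>qH_linearization\<close>): the result is the triple
  series with \<open>\<rho>12 = a b\<close>. For \<open>q = 1\<close> the identity is the Markov factorization of a
  Gaussian density.

  The three finite identities are proved through generating functions: in each case both sides satisfy the same first order
  \<open>q\<close>-difference equation. All interchanges of summation rest on \<open>ASC_growth\<close>: normalized by its natural
  \<open>L\<^sup>2\<close>-norm \<open>sqrt ([n]! (\<rho>\<^sup>2)\<^sub>n)\<close>, the polynomial \<open>P\<^sub>n\<close> grows more slowly than every geometric sequence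
  of ratio greater than \<open>1\<close>, on the whole of \<open>Sq q\<close>, endpoints included.
\<close>

section \<open>The \<open>q\<close>-numbers and the three-term recurrences\<close>

lemma qint_Suc: "qint (Suc n) q = qint n q + q ^ n"
  by (simp add: qint_def)

lemma qint_0 [simp]: "qint 0 q = 0" and qint_1 [simp]: "qint (Suc 0) q = 1"
  by (simp_all add: qint_def)

lemma qint_add: "qint (m + n) q = qint m q + q ^ m * qint n q"
  by (induction n) (simp_all add: qint_Suc algebra_simps power_add)

lemma qint_closed: "(1 - q) * qint n q = 1 - q ^ n"
  by (simp add: qint_def one_diff_power_eq)

lemma qfact_0 [simp]: "qfact 0 q = 1"
  by (simp add: qfact_def)

lemma qfact_Suc: "qfact (Suc n) q = qint (Suc n) q * qfact n q"
  by (simp add: qfact_def)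

lemma qpoch_0 [simp]: "qpoch a q 0 = 1"
  by (simp add: qpoch_def)

lemma qpoch_Suc: "qpoch a q (Suc n) = qpoch a q n * (1 - a * q ^ n)"
  by (simp add: qpoch_def)

lemma qint_pos:
  assumes "-1 < q" "q \<le> 1" shows "qint (Suc n) q > 0"
proof (cases "q = 1")
  case False
  have "\<bar>q ^ Suc n\<bar> < 1"
    using assms False by (cases "q = 0") (auto simp: power_abs abs_less_iff intro!: power_Suc_less_one simp del: power_Suc)
  then have "(1 - q) * qint (Suc n) q > 0" unfolding qint_closed by auto
  then show ?thesis using assms by (simp add: zero_less_mult_iff)
qed (simp add: qint_def)

lemma qfact_pos:
  assumes "-1 < q" "q \<le> 1" shows "qfact n q > 0"
  by (induction n) (simp_all add: qfact_Suc qint_pos[OF assms])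

lemma one_minus_pos:
  fixes a q :: real
  assumes "\<bar>a\<bar> < 1" "\<bar>q\<bar> \<le> 1" shows "1 - a * q ^ n > 0"
proof -
  have "\<bar>a * q ^ n\<bar> \<le> \<bar>a\<bar>"
    using assms by (simp add: abs_mult power_abs mult_left_le power_le_one)
  then show ?thesis using assms by linarith
qed

lemma qpoch_pos:
  assumes "\<bar>a\<bar> < 1" "\<bar>q\<bar> \<le> 1" shows "qpoch a q n > 0"
  unfolding qpoch_def by (intro prod_pos) (use one_minus_pos[OF assms] in auto)

lemma qH_eq_ASC: "qH n x q = ASC n x y 0 q"
  by (induction n x q rule: qH.induct) simp_all

lemma qH_Suc: "qH (Suc n) x q = x * qH n x q - qint n q * qH (n - 1) x q"
  by (cases n) simp_all

lemma ASC_Suc: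
  "ASC (Suc n) x y \<rho> q = (x - \<rho> * y * q ^ n) * ASC n x y \<rho> q
     - (1 - \<rho>\<^sup>2 * q ^ (n - 1)) * qint n q * ASC (n - 1) x y \<rho> q"
  by (cases n) simp_all


section \<open>The \<open>q\<close>-derivative of formal power series\<close>

unbundle no vec_syntax and fps_syntax

text \<open>
  \<open>qscale q\<close> is \<open>F(u) \<mapsto> F(q u)\<close> and \<open>qderiv q\<close> is the Jackson derivative, written with \<open>1 + q + \<dots> + q\<^sup>n\<close>
  instead of a quotient so that it makes sense for \<open>q = 1\<close>. The coefficients lie in an
  arbitrary commutative ring because the linearization formula needs series in one variable whose
  coefficients are series in another.
\<close>

definition qscale :: "'a::comm_ring_1 \<Rightarrow> 'a fps \<Rightarrow> 'a fps" where
  "qscale q F = Abs_fps (\<lambda>n. q ^ n * F $ n)"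

definition qderiv :: "'a::comm_ring_1 \<Rightarrow> 'a fps \<Rightarrow> 'a fps" where
  "qderiv q F = Abs_fps (\<lambda>n. (\<Sum>i<Suc n. q ^ i) * F $ Suc n)"

lemma qscale_nth [simp]: "qscale q F $ n = q ^ n * F $ n"
  by (simp add: qscale_def)

lemma qderiv_nth: "qderiv q F $ n = (\<Sum>i<Suc n. q ^ i) * F $ Suc n"
  by (simp add: qderiv_def)

lemma qscale_mult: "qscale q (F * G) = qscale q F * qscale q G"
proof (rule fps_ext)
  fix n
  show "qscale q (F * G) $ n = (qscale q F * qscale q G) $ n"
    unfolding qscale_nth fps_mult_nth sum_distrib_left
  proof (rule sum.cong)
    fix i assume "i \<in> {0..n}"
    then have "q ^ n = q ^ i * q ^ (n - i)" by (simp flip: power_add)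
    then show "q ^ n * (F $ i * G $ (n - i)) = q ^ i * F $ i * (q ^ (n - i) * G $ (n - i))"
      by (simp add: mult_ac)
  qed simp
qed

text \<open>
  The splitting \<open>[n] = [i] + q\<^sup>i [n - i]\<close> distributes the factor \<open>[n]\<close> over the Cauchy product. Together
  with \<open>qderiv_mult'\<close>, where \<open>qscale\<close> falls on the other factor, it takes the place of identities between
  \<open>q\<close>-binomial coefficients in the proofs below.
\<close>

lemma qderiv_mult:
  "qderiv q (F * G) = qderiv q F * G + qscale q F * qderiv q G"
proof (rule fps_ext)
  fix n
  define b where "b = (\<lambda>n. \<Sum>i<n. q ^ i)"
  have b_add: "b (m + n) = b m + q ^ m * b n" for m n
    unfolding b_def by (induction n) (simp_all add: algebra_simps power_add)
  have b0: "b 0 = 0" by (simp add: b_def)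
  have "qderiv q (F * G) $ n = (\<Sum>i\<le>Suc n. b (Suc n) * (F $ i * G $ (Suc n - i)))"
    unfolding qderiv_nth fps_mult_nth b_def atLeast0AtMost by (rule sum_distrib_left)
  also have "\<dots> = (\<Sum>i\<le>Suc n. b i * F $ i * G $ (Suc n - i)
                       + q ^ i * F $ i * (b (Suc n - i) * G $ (Suc n - i)))"
  proof (rule sum.cong)
    fix i assume "i \<in> {..Suc n}"
    then have "b (Suc n) = b i + q ^ i * b (Suc n - i)"
      using b_add[of i "Suc n - i"] by simp
    then show "b (Suc n) * (F $ i * G $ (Suc n - i)) = b i * F $ i * G $ (Suc n - i)
                       + q ^ i * F $ i * (b (Suc n - i) * G $ (Suc n - i))"
      by (simp only:) (simp add: algebra_simps)
  qed simp
  also have "\<dots> = (\<Sum>i\<le>Suc n. b i * F $ i * G $ (Suc n - i))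
                  + (\<Sum>i\<le>Suc n. q ^ i * F $ i * (b (Suc n - i) * G $ (Suc n - i)))"
    by (rule sum.distrib)
  also have "(\<Sum>i\<le>Suc n. b i * F $ i * G $ (Suc n - i)) = (qderiv q F * G) $ n"
    by (subst sum.atMost_Suc_shift)
       (simp add: fps_mult_nth qderiv_nth b0 atLeast0AtMost, simp add: b_def)
  also have "(\<Sum>i\<le>Suc n. q ^ i * F $ i * (b (Suc n - i) * G $ (Suc n - i)))
               = (qscale q F * qderiv q G) $ n"
    by (simp add: fps_mult_nth qderiv_nth b0 atLeast0AtMost)
       (auto simp: Suc_diff_le b_def intro!: sum.cong)
  finally show "qderiv q (F * G) $ n = (qderiv q F * G + qscale q F * qderiv q G) $ n"
    by simp
qed

lemma qderiv_mult':
  "qderiv q (F * G) = qderiv q F * qscale q G + F * qderiv q G"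
  using qderiv_mult[of q G F] by (simp add: mult_ac add_ac)


section \<open>Connection and linearization formulas\<close>

lemma qderiv_scaled_nth:
  "F $ Suc n = c / qfact (Suc n) q \<Longrightarrow> -1 < q \<Longrightarrow> q \<le> 1 \<Longrightarrow> qderiv q F $ n = c / qfact n q"
  using qint_pos[of q n] by (simp add: qderiv_nth qfact_Suc qint_def del: sum.lessThan_Suc)

definition qH_fps :: "real \<Rightarrow> real \<Rightarrow> real fps" where
  "qH_fps x q = Abs_fps (\<lambda>n. qH n x q / qfact n q)"

definition ASC_fps :: "real \<Rightarrow> real \<Rightarrow> real \<Rightarrow> real \<Rightarrow> real fps" where
  "ASC_fps x y \<rho> q = Abs_fps (\<lambda>n. ASC n x y \<rho> q / qfact n q)"

lemma qfact_pred: "n > 0 \<Longrightarrow> qfact n q = qint n q * qfact (n - 1) q"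
  by (cases n) (simp_all add: qfact_Suc)

context
  fixes q :: real
  assumes q: "-1 < q" "q \<le> 1"
begin

lemma qint_nz: "n > 0 \<Longrightarrow> qint n q \<noteq> 0"
  using qint_pos[OF q, of "n - 1"] by simp

lemma qfact_nz: "qfact n q \<noteq> 0"
  using qfact_pos[OF q, of n] by simp

lemma qderiv_qH_fps: "qderiv q (qH_fps z q) = (fps_const z - fps_X) * qH_fps z q"
proof (rule fps_ext)
  fix n
  have "qderiv q (qH_fps z q) $ n = qH (Suc n) z q / qfact n q"
    by (rule qderiv_scaled_nth[OF _ q]) (simp add: qH_fps_def)
  also have "\<dots> = ((fps_const z - fps_X) * qH_fps z q) $ n"
    using qint_nz[of n] qfact_nz[of "n - 1"]
    by (cases "n = 0")
       (simp_all add: qH_fps_def qH_Suc left_diff_distrib fps_X_mult_nth qfact_pred field_simps)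
  finally show "qderiv q (qH_fps z q) $ n = ((fps_const z - fps_X) * qH_fps z q) $ n" .
qed

text \<open>
  The equation determines each coefficient from the two preceding ones, since \<open>[n] \<noteq> 0\<close> for \<open>n > 0\<close>.
\<close>

lemma qH_fps_unique:
  assumes "qderiv q F = (fps_const z - fps_X) * F"
  shows "F = fps_const (F $ 0) * qH_fps z q"
proof -
  have "F $ n * qfact n q = F $ 0 * qH n z q" for n
  proof (induction n rule: less_induct)
    case (less n)
    show ?case
    proof (cases n)
      case (Suc m)
      have "F $ n * qfact n q = qderiv q F $ m * qfact m q"
        by (simp add: Suc qderiv_nth qfact_Suc qint_def del: sum.lessThan_Suc)
      also have "\<dots> = (z * F $ m - (if m = 0 then 0 else F $ (m - 1))) * qfact m q"
        unfolding assms by (simp add: left_diff_distrib fps_X_mult_nth)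
      also have "\<dots> = z * (F $ m * qfact m q)
                      - qint m q * (if m = 0 then 0 else F $ (m - 1) * qfact (m - 1) q)"
        by (simp add: qfact_pred algebra_simps)
      also have "\<dots> = z * (F $ 0 * qH m z q) - qint m q * (F $ 0 * qH (m - 1) z q)"
        using less[of m] less[of "m - 1"] Suc by simp
      finally show ?thesis by (simp add: Suc qH_Suc algebra_simps)
    qed simp
  qed
  then show ?thesis
    using qfact_nz by (intro fps_ext) (simp add: qH_fps_def field_simps)
qed

text \<open>
  The powers of \<open>q\<close> in the Al-Salam--Chihara recurrence become applications of \<open>qscale\<close> to the generating
  function.
\<close>

lemma qderiv_ASC_fps:
  "qderiv q (ASC_fps x y \<rho> q) = fps_const x * ASC_fps x y \<rho> q
     - fps_const (\<rho> * y) * qscale q (ASC_fps x y \<rho> q)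
     - fps_X * ASC_fps x y \<rho> q + fps_const (\<rho>\<^sup>2) * (fps_X * qscale q (ASC_fps x y \<rho> q))"
  (is "_ = ?R")
proof (rule fps_ext)
  fix n
  have "qderiv q (ASC_fps x y \<rho> q) $ n = ASC (Suc n) x y \<rho> q / qfact n q"
    by (rule qderiv_scaled_nth[OF _ q]) (simp add: ASC_fps_def)
  also have "\<dots> = ?R $ n"
    using qint_nz[of n] qfact_nz[of "n - 1"]
    by (cases "n = 0")
       (simp_all add: ASC_fps_def ASC_Suc fps_X_mult_nth qfact_pred field_simps)
  finally show "qderiv q (ASC_fps x y \<rho> q) $ n = ?R $ n" .
qed

text \<open>
  The right-hand side is a coefficient of the product of the generating function of
  \<open>P\<^sub>s(z|y, \<rho>)\<close> and \<open>G(u) = \<Sum> H\<^sub>m(y) (\<rho> u)\<^sup>m / [m]!\<close>. In the \<open>q\<close>-Leibniz rule the terms that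
  contain \<open>qscale\<close> cancel and \<open>y\<close> and \<open>\<rho>\<close> disappear: the product satisfies the equation of the \<open>q\<close>-Hermite generating
  function.
\<close>

lemma qH_connection:
  "qH n z q / qfact n q
     = (\<Sum>s\<le>n. ASC s z y \<rho> q / qfact s q * (\<rho> ^ (n - s) * qH (n - s) y q / qfact (n - s) q))"
proof -
  define G where "G = Abs_fps (\<lambda>m. \<rho> ^ m * qH m y q / qfact m q)"
  have G: "qderiv q G = fps_const (\<rho> * y) * G - fps_const (\<rho>\<^sup>2) * (fps_X * G)"
    (is "_ = ?R")
  proof (rule fps_ext)
    fix n
    have "qderiv q G $ n = \<rho> ^ Suc n * qH (Suc n) y q / qfact n q"
      by (rule qderiv_scaled_nth[OF _ q]) (simp add: G_def)
    also have "\<dots> = ?R $ n"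
      using qint_nz[of n] qfact_nz[of "n - 1"]
      by (cases n)
         (simp_all add: G_def qH_Suc fps_X_mult_nth qfact_pred field_simps power2_eq_square)
    finally show "qderiv q G $ n = ?R $ n" .
  qed
  define P where "P = ASC_fps z y \<rho> q"
  have "qderiv q (P * G) = (fps_const z - fps_X) * (P * G)"
    unfolding qderiv_mult G P_def qderiv_ASC_fps by (simp add: algebra_simps)
  moreover have "(P * G) $ 0 = 1" by (simp add: P_def G_def ASC_fps_def)
  ultimately have "P * G = qH_fps z q"
    using qH_fps_unique[of "P * G" z] by simp
  then have "qH_fps z q $ n = (P * G) $ n" by simp
  then show ?thesis
    by (simp add: P_def G_def ASC_fps_def qH_fps_def fps_mult_nth atLeast0AtMost)
qed

text \<open>
  Both sides are coefficients of solutions of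
  \<open>(1 - b\<^sup>2 \<eta>) D F = (z - b y \<eta> - u) F\<close>, where \<open>D\<close> is the \<open>q\<close>-derivative and \<open>\<eta>\<close> is \<open>qscale\<close>. For the left-hand side
  this is the recurrence of \<open>P\<^sub>n(z|y, b) / (b\<^sup>2)\<^sub>n\<close>. The right-hand side is a product \<open>W K\<close> with
  \<open>D K = (z - u) K\<close>; using one form of the \<open>q\<close>-Leibniz rule for \<open>D (W K)\<close> and the other
  for \<open>\<eta> D (W K)\<close> makes \<open>(1 - b\<^sup>2 \<eta>) D W\<close> appear, and the equation of \<open>W\<close> is just what is needed
  to cancel the terms that contain \<open>\<eta>\<^sup>2 W\<close>.
\<close>

lemma ASC_inverse_connection:
  assumes b: "\<bar>b\<bar> < 1"
  shows "ASC n z y b q / (qfact n q * qpoch (b\<^sup>2) q n)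
     = (\<Sum>s\<le>n. (-b) ^ s * q ^ (s choose 2) * ASC s y z b q / (qfact s q * qpoch (b\<^sup>2) q s)
                 * (qH (n - s) z q / qfact (n - s) q))"
proof -
  have b2: "\<bar>b\<^sup>2\<bar> < 1" using b by (simp add: abs_square_less_1)
  have nz: "1 - b\<^sup>2 * q ^ n \<noteq> 0" for n
    using one_minus_pos[OF b2, of q n] q by (simp add: abs_le_iff)
  have pnz: "qpoch (b\<^sup>2) q n \<noteq> 0" for n
    using qpoch_pos[OF b2, of q n] q by (simp add: abs_le_iff)
  define W where "W = Abs_fps (\<lambda>s. (-b) ^ s * q ^ (s choose 2) * ASC s y z b q
                              / (qfact s q * qpoch (b\<^sup>2) q s))"
  define V where "V = Abs_fps (\<lambda>s. ASC s z y b q / (qfact s q * qpoch (b\<^sup>2) q s))"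
  define K where "K = qH_fps z q"
  have W: "qderiv q W - fps_const (b\<^sup>2) * qscale q (qderiv q W)
      = fps_const (b\<^sup>2 * z) * qscale q (qscale q W) - fps_const (b * y) * qscale q W
        - fps_const (b\<^sup>2 * q) * (fps_X * qscale q (qscale q W))" (is "?L = ?R")
  proof (rule fps_ext)
    fix n
    have "qderiv q W $ n = ((-b) ^ Suc n * q ^ (Suc n choose 2) * ASC (Suc n) y z b q
              / qpoch (b\<^sup>2) q (Suc n)) / qfact n q"
      by (rule qderiv_scaled_nth[OF _ q]) (simp add: W_def mult.commute)
    then have "?L $ n = (-b) ^ Suc n * q ^ (Suc n choose 2) * ASC (Suc n) y z b q
              / (qpoch (b\<^sup>2) q n * qfact n q)"
      using nz[of n] pnz[of n] qfact_nz[of n] by (simp add: qpoch_Suc field_simps)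
    also have "\<dots> = ?R $ n"
    proof (cases n)
      case (Suc m)
      have c: "Suc (Suc m) choose 2 = (m choose 2) + m + Suc m" "Suc m choose 2 = (m choose 2) + m"
        by (simp_all add: numeral_2_eq_2)
      define Q where "Q = q ^ m"
      define k where "k = (-b) ^ m * q ^ (m choose 2)"
      define r1 where "r1 = ASC n y z b q / (qpoch (b\<^sup>2) q n * qfact n q)"
      define r0 where "r0 = ASC m y z b q / (qpoch (b\<^sup>2) q m * qfact m q)"
      have "ASC (Suc n) y z b q / (qpoch (b\<^sup>2) q n * qfact n q) = (y - b * z * (q * Q)) * r1 - r0"
        using nz[of m] pnz[of m] qint_nz[of "Suc m"] qfact_nz[of m]
        by (simp add: Suc r1_def r0_def qpoch_Suc qfact_Suc Q_def diff_divide_distrib)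
      moreover have "(-b) ^ Suc n * q ^ (Suc n choose 2) = b\<^sup>2 * q * Q\<^sup>2 * k"
        unfolding Suc c by (simp add: k_def Q_def power_add power2_eq_square)
      ultimately have L: "(-b) ^ Suc n * q ^ (Suc n choose 2) * ASC (Suc n) y z b q
              / (qpoch (b\<^sup>2) q n * qfact n q) = b\<^sup>2 * q * Q\<^sup>2 * k * ((y - b * z * (q * Q)) * r1 - r0)"
        by (metis times_divide_eq_right)
      have "W $ n = - b * Q * k * r1"
        by (simp add: W_def r1_def k_def Q_def Suc c power_add ac_simps del: ASC.simps)
      moreover have "W $ m = k * r0"
        by (simp add: W_def r0_def k_def ac_simps)
      ultimately show ?thesis
        unfolding L by (simp add: Suc Q_def[symmetric] power2_eq_square algebra_simps)
    qed (simp add: W_def fps_X_mult_nth numeral_2_eq_2 power2_eq_square algebra_simps)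
    finally show "?L $ n = ?R $ n" .
  qed
  have V: "qderiv q V - fps_const (b\<^sup>2) * qscale q (qderiv q V)
      = fps_const z * V - fps_const (b * y) * qscale q V - fps_X * V" (is "?L = ?R")
  proof (rule fps_ext)
    fix n
    have "qderiv q V $ n = (ASC (Suc n) z y b q / qpoch (b\<^sup>2) q (Suc n)) / qfact n q"
      by (rule qderiv_scaled_nth[OF _ q]) (simp add: V_def mult.commute)
    then have "?L $ n = ASC (Suc n) z y b q / (qpoch (b\<^sup>2) q n * qfact n q)"
      using nz[of n] pnz[of n] qfact_nz[of n] by (simp add: qpoch_Suc field_simps)
    also have "\<dots> = ?R $ n"
    proof (cases n)
      case (Suc m)
      have "ASC (Suc n) z y b q / (qpoch (b\<^sup>2) q n * qfact n q)
          = (z - b * y * q ^ n) * V $ n - V $ m"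
        using nz[of m] pnz[of m] qint_nz[of "Suc m"] qfact_nz[of m]
        by (simp add: Suc V_def qpoch_Suc qfact_Suc diff_divide_distrib)
           (simp add: ac_simps)
      then show ?thesis by (simp add: Suc fps_X_mult_nth algebra_simps)
    qed (simp add: V_def fps_X_mult_nth)
    finally show "?L $ n = ?R $ n" .
  qed
  have K: "qderiv q K = (fps_const z - fps_X) * K"
    unfolding K_def by (rule qderiv_qH_fps)
  have sc: "qscale q (fps_const z - fps_X) = fps_const z - fps_const q * fps_X"
    by (rule fps_ext) (auto simp: fps_X_def)
  define U where "U = W * K"
  have "qderiv q U - fps_const (b\<^sup>2) * qscale q (qderiv q U)
      = (qderiv q W - fps_const (b\<^sup>2) * qscale q (qderiv q W)) * qscale q K
        + W * ((fps_const z - fps_X) * K)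
        - fps_const (b\<^sup>2) * (qscale q (qscale q W) * ((fps_const z - fps_const q * fps_X) * qscale q K))"
  proof -
    have 1: "qderiv q U = qderiv q W * qscale q K + W * ((fps_const z - fps_X) * K)"
      unfolding U_def qderiv_mult' K ..
    have "qderiv q U = qderiv q W * K + qscale q W * ((fps_const z - fps_X) * K)"
      unfolding U_def qderiv_mult K ..
    moreover have "qscale q (F + G) = qscale q F + qscale q G" for F G :: "real fps"
      by (rule fps_ext) (simp add: algebra_simps)
    ultimately have 2: "qscale q (qderiv q U) = qscale q (qderiv q W) * qscale q K
        + qscale q (qscale q W) * ((fps_const z - fps_const q * fps_X) * qscale q K)"
      by (simp add: qscale_mult sc)
    show ?thesis by (subst 1, subst 2) (simp add: algebra_simps)
  qed
  also have "\<dots> = fps_const z * U - fps_const (b * y) * qscale q U - fps_X * U"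
    unfolding W U_def qscale_mult by (simp add: algebra_simps flip: fps_const_mult)
  finally have U: "qderiv q U - fps_const (b\<^sup>2) * qscale q (qderiv q U)
      = fps_const z * U - fps_const (b * y) * qscale q U - fps_X * U" .
  \<comment> \<open>Coefficientwise the equation is a recurrence with nonzero leading factor, so it has one solution with given constant term.\<close>
  have step: "qint (Suc n) q * (1 - b\<^sup>2 * q ^ n) * F $ Suc n
       = (z - b * y * q ^ n) * F $ n - (if n = 0 then 0 else F $ (n - 1))"
    if "qderiv q F - fps_const (b\<^sup>2) * qscale q (qderiv q F)
      = fps_const z * F - fps_const (b * y) * qscale q F - fps_X * F" for F n
  proof -
    have "qint (Suc n) q * (1 - b\<^sup>2 * q ^ n) * F $ Suc n
        = (qderiv q F - fps_const (b\<^sup>2) * qscale q (qderiv q F)) $ n"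
      by (simp add: qderiv_nth qint_def algebra_simps del: sum.lessThan_Suc)
    also have "\<dots> = (z - b * y * q ^ n) * F $ n - (if n = 0 then 0 else F $ (n - 1))"
      unfolding that by (simp add: fps_X_mult_nth algebra_simps)
    finally show ?thesis .
  qed
  have "U $ n = V $ n" for n
  proof (induction n rule: less_induct)
    case (less n)
    show ?case
    proof (cases n)
      case 0
      then show ?thesis by (simp add: U_def V_def W_def K_def qH_fps_def numeral_2_eq_2)
    next
      case (Suc m)
      have "qint (Suc m) q * (1 - b\<^sup>2 * q ^ m) * U $ Suc m
          = qint (Suc m) q * (1 - b\<^sup>2 * q ^ m) * V $ Suc m"
        unfolding step[OF U] step[OF V] using less[of m] less[of "m - 1"] Suc by simp
      then show ?thesis using nz[of m] qint_nz[of "Suc m"] Suc by simp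
    qed
  qed
  then have "V $ n = (W * K) $ n" by (simp add: U_def)
  then show ?thesis
    by (simp add: V_def W_def K_def qH_fps_def fps_mult_nth atLeast0AtMost)
qed

text \<open>
  Fix the generating function \<open>K(u) = \<Sum> H\<^sub>n u\<^sup>n / [n]!\<close> and let \<open>T\<^sub>i = D\<^sup>i K\<close> be its \<open>q\<close>-derivatives. The claim
  is the identity \<open>H\<^sub>m / [m]! K = \<Sum>\<^sub>j u\<^sup>j / [j]! T\<^bsub>m-j\<^esub> / [m - j]!\<close>, and its right-hand side
  is the coefficient of \<open>v\<^sup>m\<close> in the product of \<open>e(v) = \<Sum> (u v)\<^sup>j / [j]!\<close> and \<open>S(v) = \<Sum> T\<^sub>i v\<^sup>i / [i]!\<close>. As a series
  in \<open>v\<close> over the ring of series in \<open>u\<close>, this product satisfies the equation of the \<open>q\<close>-Hermite generating function.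
\<close>

lemma qH_linearization:
  "qH m z q / qfact m q * (qH n z q / qfact n q)
     = (\<Sum>j\<le>min m n. qH ((m - j) + (n - j)) z q / (qfact j q * qfact (m - j) q * qfact (n - j) q))"
proof -
  define T where "T i = Abs_fps (\<lambda>n. qH (i + n) z q / qfact n q)" for i
  define e where "e = Abs_fps (\<lambda>j. fps_const (1 / qfact j q) * fps_X ^ j)"
  define S where "S = Abs_fps (\<lambda>i. fps_const (1 / qfact i q) * T i)"
  let ?X = "fps_const (fps_X :: real fps)"
  have b: "(\<Sum>i<n. fps_const q ^ i) = fps_const (qint n q)" for n
    unfolding qint_def by (induction n) (simp_all flip: fps_const_add)
  have D: "qderiv (fps_const q) F $ n = fps_const (qint (Suc n) q) * F $ Suc n" for F n
    unfolding qderiv_nth b ..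
  have e: "qderiv (fps_const q) e = ?X * e"
  proof (rule fps_ext)
    fix n
    show "qderiv (fps_const q) e $ n = (?X * e) $ n"
      using qint_nz[of "Suc n"] qfact_nz[of n]
      by (simp add: D e_def qfact_Suc mult.assoc[symmetric])
  qed
  have T: "T (Suc i) = fps_const z * T i - fps_const (qint i q) * T (i - 1)
              - fps_const (q ^ i) * (fps_X * T i)" for i
  proof (rule fps_ext)
    fix n
    show "T (Suc i) $ n = (fps_const z * T i - fps_const (qint i q) * T (i - 1)
              - fps_const (q ^ i) * (fps_X * T i)) $ n"
    proof (cases "n = 0")
      case True
      then show ?thesis by (simp add: T_def qH_Suc fps_X_mult_nth)
    next
      case False
      then obtain k where k: "n = Suc k" by (cases n) auto
      have "qint (i + n) q = qint i q + q ^ i * qint n q" by (rule qint_add)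
      moreover have "qint i q * qH (i + n - 1) z q = qint i q * qH (i - 1 + n) z q"
        by (cases i) simp_all
      ultimately have "qint (i + n) q * qH (i + n - 1) z q
          = qint i q * qH (i - 1 + n) z q + q ^ i * qint n q * qH (i + k) z q"
        by (simp add: k algebra_simps)
      moreover have "qH (Suc (i + n)) z q = z * qH (i + n) z q - qint (i + n) q * qH (i + n - 1) z q"
        by (rule qH_Suc)
      ultimately have "qH (Suc (i + n)) z q = z * qH (i + n) z q
          - qint i q * qH (i - 1 + n) z q - q ^ i * qint n q * qH (i + k) z q"
        by simp
      then show ?thesis
        using qint_nz[of n] qfact_nz[of k]
        by (simp add: T_def fps_X_mult_nth k qfact_Suc field_simps del: qH.simps)
    qed
  qed
  have S: "qderiv (fps_const q) S
      = fps_const (fps_const z) * S - fps_X * S - ?X * qscale (fps_const q) S" (is "?L = ?R")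
  proof (rule fps_ext)
    fix n
    have "?L $ n = fps_const (1 / qfact n q) * T (Suc n)"
      using qint_nz[of "Suc n"] qfact_nz[of n]
      by (simp add: D S_def qfact_Suc mult.assoc[symmetric])
    also have "\<dots> = ?R $ n"
    proof (cases n)
      case 0
      then show ?thesis by (simp add: T S_def fps_X_mult_nth algebra_simps)
    next
      case (Suc k)
      have "fps_const (1 / qfact n q) * (fps_const (qint n q) * T (n - 1))
          = fps_const (1 / qfact k q) * T k"
        using qint_nz[of n] by (simp add: Suc qfact_Suc mult.assoc[symmetric])
      then show ?thesis
        unfolding T by (simp add: S_def fps_X_mult_nth right_diff_distrib Suc)
    qed
    finally show "?L $ n = ?R $ n" .
  qed
  define E where "E = e * S"
  have E: "qderiv (fps_const q) E = (fps_const (fps_const z) - fps_X) * E"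
    unfolding E_def qderiv_mult' e S by (simp add: algebra_simps)
  have "fps_const (qfact m q) * E $ m = fps_const (qH m z q) * qH_fps z q" for m
  proof (induction m rule: less_induct)
    case (less m)
    show ?case
    proof (cases m)
      case 0
      then show ?thesis by (simp add: E_def e_def S_def T_def qH_fps_def)
    next
      case (Suc k)
      have "fps_const (qfact m q) * E $ m = fps_const (qfact k q) * qderiv (fps_const q) E $ k"
        by (simp add: Suc D qfact_Suc mult.assoc[symmetric])
      also have "\<dots> = fps_const z * (fps_const (qfact k q) * E $ k)
                    - (if k = 0 then 0 else fps_const (qfact k q) * E $ (k - 1))"
        unfolding E by (simp add: left_diff_distrib right_diff_distrib fps_X_mult_nth mult_ac)
      also have "\<dots> = fps_const z * (fps_const (qfact k q) * E $ k)
                    - fps_const (qint k q) * (fps_const (qfact (k - 1) q) * E $ (k - 1))"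
        by (simp add: qfact_pred mult.assoc[symmetric])
      also have "\<dots> = (fps_const z * fps_const (qH k z q)
                      - fps_const (qint k q) * fps_const (qH (k - 1) z q)) * qH_fps z q"
      proof -
        have "fps_const (qfact k q) * E $ k = fps_const (qH k z q) * qH_fps z q"
          "fps_const (qfact (k - 1) q) * E $ (k - 1) = fps_const (qH (k - 1) z q) * qH_fps z q"
          using less Suc by simp_all
        then show ?thesis by (simp only: left_diff_distrib mult.assoc)
      qed
      also have "\<dots> = fps_const (qH m z q) * qH_fps z q"
        by (simp add: Suc qH_Suc)
      finally show ?thesis .
    qed
  qed
  from this[of m] have "(fps_const (qfact m q) * E $ m) $ n = (fps_const (qH m z q) * qH_fps z q) $ n"
    by simp
  then have "qH m z q / qfact m q * (qH n z q / qfact n q) = (E $ m) $ n"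
    using qfact_nz[of m] qfact_nz[of n]
    by (simp add: qH_fps_def eq_divide_eq divide_eq_eq mult_ac)
  also have "\<dots> = (\<Sum>j\<le>m. if j \<le> n then
       qH ((m - j) + (n - j)) z q / (qfact j q * qfact (m - j) q * qfact (n - j) q) else 0)"
  proof -
    have "E $ m = (\<Sum>j=0..m. e $ j * S $ (m - j))"
      unfolding E_def by (rule fps_mult_nth)
    then have "(E $ m) $ n = (\<Sum>j\<le>m. (e $ j * S $ (m - j)) $ n)"
      by (simp add: fps_sum_nth atLeast0AtMost)
    also have "\<dots> = (\<Sum>j\<le>m. if j \<le> n then
       qH ((m - j) + (n - j)) z q / (qfact j q * qfact (m - j) q * qfact (n - j) q) else 0)"
    proof (rule sum.cong)
      fix j
      have "e $ j * S $ (m - j)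
          = fps_const (1 / qfact j q) * (fps_const (1 / qfact (m - j) q) * (fps_X ^ j * T (m - j)))"
        by (simp add: e_def S_def mult_ac del: fps_const_mult)
      then show "(e $ j * S $ (m - j)) $ n = (if j \<le> n then
          qH ((m - j) + (n - j)) z q / (qfact j q * qfact (m - j) q * qfact (n - j) q) else 0)"
        by (simp add: T_def fps_X_power_mult_nth mult_ac del: fps_const_mult)
    qed simp
    finally show ?thesis .
  qed
  also have "\<dots> = (\<Sum>j\<le>min m n.
       qH ((m - j) + (n - j)) z q / (qfact j q * qfact (m - j) q * qfact (n - j) q))"
    by (rule sum.mono_neutral_cong_right) auto
  finally show ?thesis .
qed

end

unbundle no fps_syntax and vec_syntax

section \<open>Growth of the polynomials\<close>

text \<open>
  The limiting recurrence \<open>u\<^bsub>n+2\<^esub> = \<xi> u\<^bsub>n+1\<^esub> - u\<^sub>n\<close> has characteristic roots \<open>e\<close> and its conjugate, both of modulus \<open>1\<close>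
  because \<open>|\<xi>| \<le> 2\<close>. At \<open>|\<xi>| = 2\<close> they coincide and solutions may grow linearly, so no bounded energy is
  available. Instead \<open>g\<^sub>n = u\<^bsub>n+1\<^esub> - e u\<^sub>n\<close> satisfies a first order recurrence with multiplier of modulus \<open>1\<close>, and the weighted
  quantity \<open>|u\<^sub>n| + A |g\<^sub>n|\<close> eventually grows by a factor at most \<open>r\<close> per step once \<open>A\<close> is large compared
  with \<open>1 / (r - 1)\<close>.
\<close>

lemma perturbed_recurrence_growth:
  fixes u \<alpha> \<beta> :: "nat \<Rightarrow> real"
  assumes rec: "\<And>n. u (Suc (Suc n)) = \<alpha> n * u (Suc n) - \<beta> n * u n"
    and \<alpha>: "\<alpha> \<longlonglongrightarrow> \<xi>" and \<beta>: "\<beta> \<longlonglongrightarrow> 1" and \<xi>: "\<bar>\<xi>\<bar> \<le> 2" and r: "r > 1"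
  obtains C where "C > 0" "\<And>n. \<bar>u n\<bar> \<le> C * r ^ n"
proof -
  define e where "e = Complex (\<xi> / 2) (sqrt (1 - (\<xi> / 2)\<^sup>2))"
  have "(\<xi> / 2)\<^sup>2 \<le> 1"
    using \<xi> by (intro abs_square_le_1[THEN iffD2]) auto
  then have e1: "cmod e = 1" by (simp add: e_def cmod_def)
  have e_sum: "e + cnj e = of_real \<xi>"
    by (simp add: e_def complex_eq_iff)
  have e_prod: "cnj e * e = 1"
    using e1 by (simp add: complex_norm_square[symmetric] mult.commute)
  define g where "g n = of_real (u (Suc n)) - e * of_real (u n)" for n
  define \<epsilon> where "\<epsilon> n = \<bar>\<alpha> n - \<xi>\<bar> + \<bar>1 - \<beta> n\<bar>" for n
  define A where "A = 2 / (r - 1)"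
  define N where "N n = \<bar>u n\<bar> + A * cmod (g n)" for n
  have A: "A > 0" using r by (simp add: A_def)
  have g_rec: "g (Suc n) = cnj e * g n + of_real ((\<alpha> n - \<xi>) * u (Suc n) + (1 - \<beta> n) * u n)" for n
  proof -
    have "g (Suc n) = (of_real \<xi> - e) * of_real (u (Suc n)) - 1 * of_real (u n)
             + of_real ((\<alpha> n - \<xi>) * u (Suc n) + (1 - \<beta> n) * u n)"
      by (simp add: g_def rec algebra_simps)
    also have "of_real \<xi> - e = cnj e" using e_sum by (simp add: algebra_simps)
    also have "(1::complex) = cnj e * e" by (rule e_prod[symmetric])
    finally show ?thesis by (simp add: g_def algebra_simps)
  qed
  have u_le: "\<bar>u (Suc n)\<bar> \<le> \<bar>u n\<bar> + cmod (g n)" for n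
  proof -
    have "cmod (of_real (u (Suc n))) = cmod (e * of_real (u n) + g n)"
      by (simp add: g_def)
    also have "\<dots> \<le> cmod (e * of_real (u n)) + cmod (g n)" by (rule norm_triangle_ineq)
    finally show ?thesis by (simp add: norm_mult e1)
  qed
  have g_le: "cmod (g (Suc n)) \<le> cmod (g n) + \<epsilon> n * (2 * \<bar>u n\<bar> + cmod (g n))" for n
  proof -
    have "cmod (g (Suc n)) \<le> cmod (g n) + \<bar>(\<alpha> n - \<xi>) * u (Suc n) + (1 - \<beta> n) * u n\<bar>"
      unfolding g_rec by (rule norm_triangle_le) (simp add: norm_mult e1 del: of_real_add of_real_mult)
    also have "\<bar>(\<alpha> n - \<xi>) * u (Suc n) + (1 - \<beta> n) * u n\<bar>
        \<le> \<bar>\<alpha> n - \<xi>\<bar> * \<bar>u (Suc n)\<bar> + \<bar>1 - \<beta> n\<bar> * \<bar>u n\<bar>"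
      by (metis abs_mult abs_triangle_ineq)
    also have "\<dots> \<le> \<epsilon> n * \<bar>u (Suc n)\<bar> + \<epsilon> n * \<bar>u n\<bar>"
      by (intro add_mono mult_right_mono) (auto simp: \<epsilon>_def)
    also have "\<dots> \<le> \<epsilon> n * (\<bar>u n\<bar> + cmod (g n)) + \<epsilon> n * \<bar>u n\<bar>"
      by (intro add_mono mult_left_mono u_le) (auto simp: \<epsilon>_def)
    finally show ?thesis by (simp add: algebra_simps)
  qed
  have "\<epsilon> \<longlonglongrightarrow> \<bar>\<xi> - \<xi>\<bar> + \<bar>1 - 1\<bar>"
    unfolding \<epsilon>_def by (intro tendsto_intros \<alpha> \<beta>)
  then have "eventually (\<lambda>n. \<epsilon> n < min ((r - 1) / 2) ((r - 1)\<^sup>2 / 4)) sequentially"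
    using r by (intro order_tendstoD) auto
  then obtain n0 where n0: "\<And>n. n \<ge> n0 \<Longrightarrow> \<epsilon> n < min ((r - 1) / 2) ((r - 1)\<^sup>2 / 4)"
    by (auto simp: eventually_sequentially)
  have N_step: "N (Suc n) \<le> r * N n" if "n \<ge> n0" for n
  proof -
    have \<epsilon>: "\<epsilon> n \<le> (r - 1) / 2" "\<epsilon> n \<le> (r - 1)\<^sup>2 / 4" using n0[OF that] by auto
    have "A * \<epsilon> n \<le> A * ((r - 1)\<^sup>2 / 4)" using A \<epsilon> by (intro mult_left_mono) auto
    also have "\<dots> = (r - 1) / 2" using r by (simp add: A_def power2_eq_square field_simps)
    finally have 1: "1 + 2 * (A * \<epsilon> n) \<le> r" by simp
    have "A * \<epsilon> n \<le> A * ((r - 1) / 2)" using A \<epsilon> by (intro mult_left_mono) auto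
    moreover have "A * ((r - 1) / 2) = 1" using r by (simp add: A_def)
    moreover have "A * (r - 1) = 2" using r by (simp add: A_def divide_simps)
    ultimately have 2: "1 + A + A * \<epsilon> n \<le> r * A" by (simp add: algebra_simps)
    have "N (Suc n) \<le> (\<bar>u n\<bar> + cmod (g n)) + A * (cmod (g n) + \<epsilon> n * (2 * \<bar>u n\<bar> + cmod (g n)))"
      unfolding N_def using A by (intro add_mono mult_left_mono u_le g_le) auto
    also have "\<dots> = (1 + 2 * (A * \<epsilon> n)) * \<bar>u n\<bar> + (1 + A + A * \<epsilon> n) * cmod (g n)"
      by (simp add: algebra_simps)
    also have "\<dots> \<le> r * \<bar>u n\<bar> + (r * A) * cmod (g n)"
      by (intro add_mono mult_right_mono 1 2) auto
    finally show ?thesis by (simp add: N_def algebra_simps)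
  qed
  have N_nonneg: "N n \<ge> 0" for n using A by (simp add: N_def)
  define C where "C = 1 + (\<Sum>i\<le>n0. N i)"
  have C: "C \<ge> 1" unfolding C_def by (simp add: sum_nonneg N_nonneg)
  have N_small: "N n \<le> C" if "n \<le> n0" for n
  proof -
    have "N n \<le> (\<Sum>i\<le>n0. N i)" by (rule member_le_sum) (use that N_nonneg in auto)
    then show ?thesis by (simp add: C_def)
  qed
  have N_large: "N (n0 + k) \<le> C * r ^ k" for k
  proof (induction k)
    case (Suc k)
    have "N (n0 + Suc k) \<le> r * N (n0 + k)" using N_step[of "n0 + k"] by simp
    also have "\<dots> \<le> r * (C * r ^ k)" using Suc r by (intro mult_left_mono) auto
    finally show ?case by (simp add: mult_ac)
  qed (use N_small[of n0] in simp)
  have "\<bar>u n\<bar> \<le> C * r ^ n" for n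
  proof -
    have "\<bar>u n\<bar> \<le> N n" using A by (simp add: N_def)
    also have "N n \<le> C * r ^ n"
    proof (cases "n \<le> n0")
      case True
      have "N n * 1 \<le> C * r ^ n"
        using N_small[OF True] C r by (intro mult_mono one_le_power) auto
      then show ?thesis by simp
    next
      case False
      then have "N n \<le> C * r ^ (n - n0)" using N_large[of "n - n0"] by simp
      also have "\<dots> \<le> C * r ^ n" using C r by (intro mult_left_mono power_increasing) auto
      finally show ?thesis .
    qed
    finally show ?thesis .
  qed
  then show thesis using C by (intro that[of C]) auto
qed

text \<open>
  After division by \<open>sqrt ([n]! (\<rho>\<^sup>2)\<^sub>n)\<close> the three-term recurrence has coefficients converging to
  \<open>x sqrt (1 - q)\<close> and \<open>1\<close>. The set \<open>Sq q\<close> is exactly where the former is at most \<open>2\<close> in modulus; for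
  \<open>q = 1\<close> it is \<open>0\<close> for every \<open>x\<close>.
\<close>

lemma ASC_growth:
  assumes q: "-1 < q" "q \<le> 1" and \<rho>: "\<bar>\<rho>\<bar> < 1" and x: "x \<in> Sq q" and r: "r > 1"
  obtains C where "C > 0"
    "\<And>n. \<bar>ASC n x y \<rho> q\<bar> \<le> C * r ^ n * sqrt (qfact n q * qpoch (\<rho>\<^sup>2) q n)"
proof -
  have \<rho>2: "\<bar>\<rho>\<^sup>2\<bar> < 1" using \<rho> by (simp add: abs_square_less_1)
  have q': "\<bar>q\<bar> \<le> 1" using q by auto
  define c where "c n = qint (Suc n) q * (1 - \<rho>\<^sup>2 * q ^ n)" for n
  have c: "c n > 0" for n
    unfolding c_def by (intro mult_pos_pos qint_pos[OF q] one_minus_pos[OF \<rho>2 q'])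
  define N where "N n = sqrt (qfact n q * qpoch (\<rho>\<^sup>2) q n)" for n
  have N: "N n > 0" for n
    unfolding N_def using qfact_pos[OF q, of n] qpoch_pos[OF \<rho>2 q', of n] by simp
  have N_Suc: "N (Suc n) = sqrt (c n) * N n" for n
    by (simp add: N_def c_def qfact_Suc qpoch_Suc mult_ac flip: real_sqrt_mult)
  define u where "u n = ASC n x y \<rho> q / N n" for n
  define \<alpha> where "\<alpha> n = (x - \<rho> * y * q ^ Suc n) / sqrt (c (Suc n))" for n
  define \<beta> where "\<beta> n = sqrt (c n / c (Suc n))" for n
  have rec: "u (Suc (Suc n)) = \<alpha> n * u (Suc n) - \<beta> n * u n" for n
  proof -
    have "u (Suc (Suc n)) = \<alpha> n * u (Suc n) - c n * ASC n x y \<rho> q / N (Suc (Suc n))"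
    proof -
      have "ASC (Suc (Suc n)) x y \<rho> q
          = (x - \<rho> * y * q ^ Suc n) * ASC (Suc n) x y \<rho> q - c n * ASC n x y \<rho> q"
        by (simp add: c_def mult_ac)
      then show ?thesis
        by (simp only: u_def N_Suc[of "Suc n"] \<alpha>_def times_divide_times_eq) (rule diff_divide_distrib)
    qed
    also have "c n * ASC n x y \<rho> q / N (Suc (Suc n))
        = (sqrt (c n) * sqrt (c n)) * ASC n x y \<rho> q / (sqrt (c (Suc n)) * (sqrt (c n) * N n))"
      using c[of n] by (simp add: N_Suc)
    also have "\<dots> = \<beta> n * u n"
      using c[of n] c[of "Suc n"] N[of n] by (simp add: u_def \<beta>_def real_sqrt_divide field_simps)
    finally show ?thesis .
  qed
  have lim: "\<alpha> \<longlonglongrightarrow> x * sqrt (1 - q) \<and> \<beta> \<longlonglongrightarrow> 1 \<and> \<bar>x * sqrt (1 - q)\<bar> \<le> 2"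
  proof (cases "q = 1")
    case True
    have p: "1 - \<rho>\<^sup>2 > 0" using \<rho>2 by auto
    have c1: "c n = (1 + real n) * (1 - \<rho>\<^sup>2)" for n by (simp add: c_def qint_def True)
    have "\<alpha> \<longlonglongrightarrow> 0"
      unfolding \<alpha>_def c1 using p by (simp add: True) real_asymp
    moreover have "\<beta> \<longlonglongrightarrow> 1"
      unfolding \<beta>_def c1 using p by (simp add: True) real_asymp
    ultimately show ?thesis by (simp add: True)
  next
    case False
    then have q1: "norm q < 1" "q < 1" using q by auto
    have c1: "c n = (1 - q ^ Suc n) / (1 - q) * (1 - \<rho>\<^sup>2 * q ^ n)" for n
    proof -
      have "qint (Suc n) q = (1 - q ^ Suc n) / (1 - q)"
        using qint_closed[of q "Suc n"] q1 by (simp add: eq_divide_eq mult.commute)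
      then show ?thesis by (simp only: c_def)
    qed
    have q0: "(\<lambda>n. q ^ n) \<longlonglongrightarrow> 0" using q1 by (intro LIMSEQ_power_zero) auto
    note q0S = LIMSEQ_Suc[OF q0]
    have c_lim: "c \<longlonglongrightarrow> (1 - 0) / (1 - q) * (1 - \<rho>\<^sup>2 * 0)"
      unfolding c1 by (intro tendsto_intros q0 q0S) (use q1 in auto)
    have "\<alpha> \<longlonglongrightarrow> (x - \<rho> * y * 0) / sqrt ((1 - 0) / (1 - q) * (1 - \<rho>\<^sup>2 * 0))"
      unfolding \<alpha>_def by (intro tendsto_intros q0S LIMSEQ_Suc[OF c_lim]) (use q1 in auto)
    moreover have "\<beta> \<longlonglongrightarrow> sqrt (((1 - 0) / (1 - q) * (1 - \<rho>\<^sup>2 * 0)) / ((1 - 0) / (1 - q) * (1 - \<rho>\<^sup>2 * 0)))"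
      unfolding \<beta>_def by (intro tendsto_intros c_lim LIMSEQ_Suc[OF c_lim]) (use q1 in auto)
    moreover have "\<bar>x\<bar> \<le> 2 / sqrt (1 - q)"
      using x False by (auto simp: Sq_def)
    then have "\<bar>x * sqrt (1 - q)\<bar> \<le> 2" using q1 by (simp add: abs_mult field_simps)
    ultimately show ?thesis using q1 by (simp add: real_sqrt_divide)
  qed
  obtain C where C: "C > 0" "\<And>n. \<bar>u n\<bar> \<le> C * r ^ n"
    using perturbed_recurrence_growth[of u \<alpha> \<beta> "x * sqrt (1 - q)" r, OF rec] lim r by metis
  have "\<bar>ASC n x y \<rho> q\<bar> \<le> C * r ^ n * N n" for n
    using C(2)[of n] N[of n] by (simp add: u_def abs_mult field_simps)
  then show thesis using C(1) that unfolding N_def by blast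
qed

lemma qH_growth:
  assumes "-1 < q" "q \<le> 1" "x \<in> Sq q" "r > 1"
  obtains C where "C > 0" "\<And>n. \<bar>qH n x q\<bar> \<le> C * r ^ n * sqrt (qfact n q)"
proof -
  have "qpoch (0\<^sup>2) q n = 1" for n by (simp add: qpoch_def)
  then show ?thesis
    using ASC_growth[OF assms(1,2) _ assms(3,4), of 0 0] that
    by (simp flip: qH_eq_ASC) blast
qed

lemma qpoch_limit:
  assumes "\<bar>q\<bar> < 1" "\<bar>a\<bar> < 1"
  shows "qpoch a q \<longlonglongrightarrow> qpoch_inf a q" and "qpoch_inf a q \<noteq> 0"
proof -
  have "summable (\<lambda>i. norm ((1 - a * q ^ i) - 1))"
    using summable_mult[OF summable_geometric[of "\<bar>q\<bar>"], of "\<bar>a\<bar>"] assms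
    by (simp add: abs_mult power_abs)
  then have cp: "convergent_prod (\<lambda>i. 1 - a * q ^ i)"
    by (intro abs_convergent_prod_imp_convergent_prod summable_imp_abs_convergent_prod)
  then have "(\<lambda>i. 1 - a * q ^ i) has_prod qpoch_inf a q"
    unfolding qpoch_inf_def by (rule convergent_prod_has_prod)
  from has_prod_imp_tendsto'[OF this] show "qpoch a q \<longlonglongrightarrow> qpoch_inf a q"
    by (simp add: qpoch_def[abs_def])
  have "1 - a * q ^ i \<noteq> 0" for i using one_minus_pos[of a q i] assms by simp
  then show "qpoch_inf a q \<noteq> 0"
    unfolding qpoch_inf_def using cp by (intro prodinf_nonzero) auto
qed

lemma qpoch_bounds:
  assumes "\<bar>q\<bar> < 1" "\<bar>a\<bar> < 1"
  obtains c C where "c > 0" "C > 0" "\<And>n. c \<le> qpoch a q n" "\<And>n. qpoch a q n \<le> C"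
proof -
  have pos: "qpoch a q n > 0" for n using assms by (intro qpoch_pos) auto
  have "Bseq (qpoch a q)" "Bseq (\<lambda>n. inverse (qpoch a q n))"
    using qpoch_limit[OF assms] by (auto intro!: convergent_imp_Bseq convergentI tendsto_inverse)
  then obtain C D where C: "C > 0" "\<And>n. \<bar>qpoch a q n\<bar> \<le> C"
    and D: "D > 0" "\<And>n. \<bar>inverse (qpoch a q n)\<bar> \<le> D"
    unfolding Bseq_def by auto
  have "inverse D \<le> qpoch a q n" for n
    using D(2)[of n] D(1) pos[of n] by (simp add: field_simps)
  moreover have "qpoch a q n \<le> C" for n using C(2)[of n] by simp
  ultimately show thesis using that[of "inverse D" C] C(1) D(1) by simp
qed

lemma qfact_one: "qfact n 1 = fact n"
  by (induction n) (simp_all add: qfact_Suc qint_def)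

lemma qpoch_one: "qpoch a 1 n = (1 - a) ^ n"
  by (simp add: qpoch_def)

lemma qfact_qpoch: "qfact n q * (1 - q) ^ n = qpoch q q n"
proof (induction n)
  case (Suc n)
  have "qfact (Suc n) q * (1 - q) ^ Suc n = (qfact n q * (1 - q) ^ n) * ((1 - q) * qint (Suc n) q)"
    by (simp add: qfact_Suc)
  then show ?case using Suc by (simp add: qint_closed qpoch_Suc)
qed simp

lemma qbinomial_bounded:
  assumes "\<bar>q\<bar> < 1"
  obtains C where "C > 0" "\<And>s m. qfact (s + m) q / (qfact s q * qfact m q) \<le> C"
proof -
  obtain c C where c: "c > 0" "C > 0" "\<And>n. c \<le> qpoch q q n" "\<And>n. qpoch q q n \<le> C"
    using qpoch_bounds[OF assms assms] by metis
  have "qfact (s + m) q / (qfact s q * qfact m q) \<le> C / (c * c)" for s m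
  proof -
    have "qfact (s + m) q / (qfact s q * qfact m q) = qpoch q q (s + m) / (qpoch q q s * qpoch q q m)"
      using assms by (simp add: power_add flip: qfact_qpoch) (auto simp: field_simps)
    also have "\<dots> \<le> C / (c * c)"
      using c(1,2) by (intro frac_le mult_mono c(3,4)) (auto intro: less_imp_le less_le_trans[OF c(1) c(3)])
    finally show ?thesis .
  qed
  then show thesis using that[of "C / (c * c)"] c by simp
qed

lemma binomial_weight_le:
  fixes v w :: real
  assumes "v \<ge> 0" "w \<ge> 0"
  shows "fact (s + m) / (fact s * fact m) * (v ^ s * w ^ m) \<le> (v + w) ^ (s + m)"
proof -
  have "fact (s + m) / (fact s * fact m) * (v ^ s * w ^ m)
      = of_nat ((s + m) choose s) * v ^ s * w ^ ((s + m) - s)"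
    by (simp add: binomial_fact mult.assoc)
  also have "\<dots> \<le> (\<Sum>k\<le>s + m. of_nat ((s + m) choose k) * v ^ k * w ^ ((s + m) - k))"
    by (rule member_le_sum) (use assms in auto)
  also have "\<dots> = (v + w) ^ (s + m)" by (rule binomial_ring[symmetric])
  finally show ?thesis .
qed

text \<open>
  The weights that appear when every polynomial in the connection formula is divided by its norm.
  For \<open>q = 1\<close> the square of a weight is a single term of the binomial
  expansion of \<open>((1 - \<rho>\<^sup>2) + \<rho>\<^sup>2)\<^bsup>s+m\<^esup>\<close>; for \<open>|q| < 1\<close> all \<open>q\<close>-factorials are comparable to powers of
  \<open>1 / (1 - q)\<close>.
\<close>

lemma connection_weight_bounded:
  assumes q: "-1 < q" "q \<le> 1" and \<rho>: "\<bar>\<rho>\<bar> < 1"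
  obtains C where "C > 0"
    "\<And>s m. \<bar>\<rho>\<bar> ^ m * sqrt (qfact (s + m) q / (qfact s q * qfact m q) * qpoch (\<rho>\<^sup>2) q s) \<le> C"
proof (cases "q = 1")
  case True
  have \<rho>2: "\<rho>\<^sup>2 \<le> 1" using \<rho> abs_square_le_1[of \<rho>] by auto
  have "\<bar>\<rho>\<bar> ^ m * sqrt (qfact (s + m) q / (qfact s q * qfact m q) * qpoch (\<rho>\<^sup>2) q s) \<le> 1" for s m
  proof -
    have "\<bar>\<rho>\<bar> ^ m * sqrt (qfact (s + m) q / (qfact s q * qfact m q) * qpoch (\<rho>\<^sup>2) q s)
        = sqrt ((\<bar>\<rho>\<bar> ^ m)\<^sup>2 * (qfact (s + m) q / (qfact s q * qfact m q) * qpoch (\<rho>\<^sup>2) q s))"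
      by (simp only: real_sqrt_mult real_sqrt_abs) simp
    also have "(\<bar>\<rho>\<bar> ^ m)\<^sup>2 = (\<rho>\<^sup>2) ^ m" by (metis power2_abs power_mult mult.commute)
    also have "(\<rho>\<^sup>2) ^ m * (qfact (s + m) q / (qfact s q * qfact m q) * qpoch (\<rho>\<^sup>2) q s)
        = fact (s + m) / (fact s * fact m) * ((1 - \<rho>\<^sup>2) ^ s * (\<rho>\<^sup>2) ^ m)"
      by (simp add: True qfact_one qpoch_one mult.commute)
    also have "\<dots> \<le> 1"
      using binomial_weight_le[of "1 - \<rho>\<^sup>2" "\<rho>\<^sup>2" s m] \<rho>2 by simp
    finally show ?thesis by simp
  qed
  then show thesis using that[of 1] by simp
next
  case False
  then have q1: "\<bar>q\<bar> < 1" and \<rho>2: "\<bar>\<rho>\<^sup>2\<bar> < 1" using q \<rho> by (auto simp: abs_square_less_1)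
  obtain C where C: "C > 0" "\<And>s m. qfact (s + m) q / (qfact s q * qfact m q) \<le> C"
    using qbinomial_bounded[OF q1] by metis
  obtain D where D: "D > 0" "\<And>n. qpoch (\<rho>\<^sup>2) q n \<le> D"
    using qpoch_bounds[OF q1 \<rho>2] by metis
  have "\<bar>\<rho>\<bar> ^ m * sqrt (qfact (s + m) q / (qfact s q * qfact m q) * qpoch (\<rho>\<^sup>2) q s)
      \<le> 1 * sqrt (C * D)" for s m
    using \<rho> C(1) qpoch_pos[OF \<rho>2, of q s] q1
    by (intro mult_mono real_sqrt_le_mono C(2) D(2) power_le_one)
       (auto simp: less_imp_le[OF qfact_pos[OF q]])
  then show thesis using that[of "sqrt (C * D)"] C D by simp
qed

text \<open>
  For \<open>q = 1\<close> the square of the left-hand side is a term of the expansion of \<open>(b\<^sup>2 / (1 - b\<^sup>2) + 1)\<^bsup>s+m\<^esup>\<close>. The exponential factor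
  \<open>1 / sqrt (1 - b\<^sup>2)\<close> is the origin of the condition \<open>a\<^sup>2 + b\<^sup>2 < 1\<close> in the case \<open>q = 1\<close> of
  the expansion for \<open>\<rho>12 = 0\<close>.
\<close>

lemma inverse_connection_weight_bounded:
  assumes q: "-1 < q" "q \<le> 1" and b: "\<bar>b\<bar> < 1"
  obtains C where "C > 0"
    "\<And>s m. \<bar>b\<bar> ^ s * sqrt (qfact (s + m) q / (qfact s q * qfact m q) / qpoch (b\<^sup>2) q s)
              \<le> C * (if q = 1 then 1 / sqrt (1 - b\<^sup>2) else 1) ^ (s + m)"
proof (cases "q = 1")
  case True
  have b2: "b\<^sup>2 < 1" using b by (simp add: abs_square_less_1)
  have "\<bar>b\<bar> ^ s * sqrt (qfact (s + m) q / (qfact s q * qfact m q) / qpoch (b\<^sup>2) q s)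
            \<le> (1 / sqrt (1 - b\<^sup>2)) ^ (s + m)" for s m
  proof -
    have "\<bar>b\<bar> ^ s * sqrt (qfact (s + m) q / (qfact s q * qfact m q) / qpoch (b\<^sup>2) q s)
        = sqrt ((\<bar>b\<bar> ^ s)\<^sup>2 * (qfact (s + m) q / (qfact s q * qfact m q) / qpoch (b\<^sup>2) q s))"
      by (simp only: real_sqrt_mult real_sqrt_abs) simp
    also have "(\<bar>b\<bar> ^ s)\<^sup>2 = (b\<^sup>2) ^ s" by (metis power2_abs power_mult mult.commute)
    also have "(b\<^sup>2) ^ s * (qfact (s + m) q / (qfact s q * qfact m q) / qpoch (b\<^sup>2) q s)
        = fact (s + m) / (fact s * fact m) * ((b\<^sup>2 / (1 - b\<^sup>2)) ^ s * 1 ^ m)"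
      by (simp add: True qfact_one qpoch_one power_divide)
    also have "\<dots> \<le> (b\<^sup>2 / (1 - b\<^sup>2) + 1) ^ (s + m)"
      using b2 by (intro binomial_weight_le) auto
    also have "b\<^sup>2 / (1 - b\<^sup>2) + 1 = 1 / (1 - b\<^sup>2)"
      using b2 by (simp add: field_simps)
    finally show ?thesis by (simp add: real_sqrt_power real_sqrt_divide)
  qed
  then show thesis using that[of 1] True by simp
next
  case False
  then have q1: "\<bar>q\<bar> < 1" and b2: "\<bar>b\<^sup>2\<bar> < 1" using q b by (auto simp: abs_square_less_1)
  obtain C where C: "C > 0" "\<And>s m. qfact (s + m) q / (qfact s q * qfact m q) \<le> C"
    using qbinomial_bounded[OF q1] by metis
  obtain d where d: "d > 0" "\<And>n. d \<le> qpoch (b\<^sup>2) q n"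
    using qpoch_bounds[OF q1 b2] by metis
  have "\<bar>b\<bar> ^ s * sqrt (qfact (s + m) q / (qfact s q * qfact m q) / qpoch (b\<^sup>2) q s)
      \<le> 1 * sqrt (C / d)" for s m
    using b C(1) d(1) qpoch_pos[OF b2, of q s] q1 qfact_pos[OF q]
    by (intro mult_mono real_sqrt_le_mono frac_le C(2) d(2) power_le_one) (auto intro: less_imp_le)
  then show thesis using that[of "sqrt (C / d)"] C d False by simp
qed

lemma exists_growth_rate:
  fixes \<theta> :: real
  assumes "0 \<le> \<theta>" "\<theta> < 1"
  obtains r where "r > 1" "r\<^sup>2 * \<theta> < 1"
proof -
  define r where "r = sqrt (2 / (1 + \<theta>))"
  have "r > 1" using assms by (simp add: r_def)
  moreover have "r\<^sup>2 * \<theta> < 1" using assms by (simp add: r_def field_simps)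
  ultimately show thesis by (rule that)
qed

section \<open>The \<open>q\<close>-Mehler formula\<close>

definition shifted_mehler :: "nat \<Rightarrow> real \<Rightarrow> real \<Rightarrow> real \<Rightarrow> real \<Rightarrow> real" where
  "shifted_mehler s x y t q = (\<Sum>m. t ^ m / qfact m q * (qH (m + s) x q * qH m y q))"

abbreviation mehler :: "real \<Rightarrow> real \<Rightarrow> real \<Rightarrow> real \<Rightarrow> real" where
  "mehler \<equiv> shifted_mehler 0"

context
  fixes q :: real
  assumes q: "-1 < q" "q \<le> 1"
begin

lemma q_abs: "\<bar>q\<bar> \<le> 1" using q by auto

lemma shifted_mehler_summable:
  assumes xy: "x \<in> Sq q" "y \<in> Sq q" and t: "\<bar>t\<bar> < 1"
  shows "summable (\<lambda>m. t ^ m / qfact m q * (qH (m + s) x q * qH m y q))"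
proof -
  \<comment> \<open>Of the two factors \<open>\<rho>\<close> of \<open>|t|\<close>, one controls the ratio of factorials and the other gives the geometric decay.\<close>
  define \<rho> where "\<rho> = sqrt \<bar>t\<bar>"
  have \<rho>: "0 \<le> \<rho>" "\<rho> < 1" "\<bar>t\<bar> = \<rho> * \<rho>" using t by (auto simp: \<rho>_def)
  obtain r where r: "r > 1" "r\<^sup>2 * \<rho> < 1" using exists_growth_rate[OF \<rho>(1,2)] .
  obtain C where C: "C > 0" "\<And>n. \<bar>qH n x q\<bar> \<le> C * r ^ n * sqrt (qfact n q)"
    using qH_growth[OF q xy(1) r(1)] by metis
  obtain D where D: "D > 0" "\<And>n. \<bar>qH n y q\<bar> \<le> D * r ^ n * sqrt (qfact n q)"
    using qH_growth[OF q xy(2) r(1)] by metis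
  obtain E where E: "E > 0"
    "\<And>s m. \<bar>\<rho>\<bar> ^ m * sqrt (qfact (s + m) q / (qfact s q * qfact m q) * qpoch (\<rho>\<^sup>2) q s) \<le> E"
    using connection_weight_bounded[OF q, of \<rho>] \<rho> by auto
  define w where "w = sqrt (qpoch (\<rho>\<^sup>2) q s / qfact s q)"
  have w: "w > 0"
    using qfact_pos[OF q, of s] qpoch_pos[of "\<rho>\<^sup>2" q s] \<rho> q_abs
    by (simp add: w_def abs_square_less_1)
  have "norm (t ^ m / qfact m q * (qH (m + s) x q * qH m y q))
      \<le> (C * D * r ^ s * E / w) * (r\<^sup>2 * \<rho>) ^ m" for m
  proof -
    have F: "qfact m q > 0" "qfact (m + s) q > 0" using qfact_pos[OF q] by auto
    have "norm (t ^ m / qfact m q * (qH (m + s) x q * qH m y q))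
        = (\<bar>t\<bar> ^ m / qfact m q) * (\<bar>qH (m + s) x q\<bar> * \<bar>qH m y q\<bar>)"
      using F by (simp add: abs_mult power_abs)
    also have "\<dots> \<le> (\<bar>t\<bar> ^ m / qfact m q) * ((C * r ^ (m + s) * sqrt (qfact (m + s) q)) *
                                           (D * r ^ m * sqrt (qfact m q)))"
      using F r C(1) by (intro mult_left_mono mult_mono C D) auto
    also have "\<dots> = C * D * r ^ s * (r\<^sup>2 * \<rho>) ^ m *
               (\<rho> ^ m * (sqrt (qfact (m + s) q) * (sqrt (qfact m q) / qfact m q)))"
      by (simp add: \<rho>(3) power_mult_distrib power_add power2_eq_square)
    also have "sqrt (qfact m q) / qfact m q = 1 / sqrt (qfact m q)"
      using F by (simp add: field_simps)
    also have "sqrt (qfact (m + s) q) * (1 / sqrt (qfact m q))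
        = sqrt (qfact (s + m) q / (qfact s q * qfact m q) * qpoch (\<rho>\<^sup>2) q s) / w"
      using F w qfact_pos[OF q, of s]
      by (simp add: w_def real_sqrt_mult real_sqrt_divide add.commute field_simps)
    also have "C * D * r ^ s * (r\<^sup>2 * \<rho>) ^ m * (\<rho> ^ m * \<dots>)
        = (C * D * r ^ s / w * (r\<^sup>2 * \<rho>) ^ m) *
          (\<bar>\<rho>\<bar> ^ m * sqrt (qfact (s + m) q / (qfact s q * qfact m q) * qpoch (\<rho>\<^sup>2) q s))"
      using \<rho>(1) by simp
    also have "\<dots> \<le> (C * D * r ^ s / w * (r\<^sup>2 * \<rho>) ^ m) * E"
      using C(1) D(1) r(1) w \<rho>(1) by (intro mult_left_mono E) auto
    finally show ?thesis by (simp add: mult_ac)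
  qed
  moreover have "summable (\<lambda>m. (C * D * r ^ s * E / w) * (r\<^sup>2 * \<rho>) ^ m)"
    using r \<rho> by (intro summable_mult summable_geometric) auto
  ultimately show ?thesis by (rule summable_comparison_test'[where N = 0, rotated])
qed


lemma sums_shift_index:
  fixes f :: "nat \<Rightarrow> real"
  assumes "f sums S"
  shows "(\<lambda>m. if m = 0 then 0 else f (m - 1)) sums S"
proof -
  have "(\<lambda>m. (\<lambda>m. if m = 0 then 0 else f (m - 1)) (Suc m)) sums (S - 0)"
    using assms by simp
  then show ?thesis by (subst (asm) sums_Suc_iff) simp
qed

lemma shifted_mehler_sums:
  assumes "x \<in> Sq q" "y \<in> Sq q" "\<bar>t\<bar> < 1"
  shows "(\<lambda>m. t ^ m / qfact m q * (qH (m + s) x q * qH m y q)) sums shifted_mehler s x y t q"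
  unfolding shifted_mehler_def by (rule summable_sums[OF shifted_mehler_summable[OF assms]])

lemma mehler_sym: "mehler x y t q = mehler y x t q"
  by (simp add: shifted_mehler_def mult.commute)

lemma qfact_Suc_cancel: "c * t ^ Suc m / qfact (Suc m) q * qint (Suc m) q = c * t * (t ^ m / qfact m q)"
  using qint_pos[OF q, of m] by (simp add: qfact_Suc del: power_Suc) simp

text \<open>
  Expand \<open>H\<^bsub>m+s+1\<^esub>(x)\<close> by the recurrence and split \<open>[m + s] = [s] + q\<^sup>s [m]\<close>. The factor \<open>[m]\<close> cancels against
  \<open>[m]!\<close> and shifts the summation index, which leaves the series \<open>b\<close> with \<open>H\<^bsub>m+1\<^esub>(y)\<close>; the same step applied to
  \<open>H\<^bsub>m+1\<^esub>(y)\<close> leads back to \<open>A\<^sub>s\<close> and \<open>A\<^bsub>s+1\<^esub>\<close>.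
\<close>

lemma shifted_mehler_Suc:
  assumes "x \<in> Sq q" "y \<in> Sq q" "\<bar>t\<bar> < 1"
  shows "(1 - t\<^sup>2 * q ^ s) * shifted_mehler (Suc s) x y t q
    = (x - t * y * q ^ s) * shifted_mehler s x y t q - qint s q * shifted_mehler (s - 1) x y t q"
proof -
  define a where "a s m = t ^ m / qfact m q * (qH (m + s) x q * qH m y q)" for s m
  define b where "b m = t ^ m / qfact m q * (qH (m + s) x q * qH (Suc m) y q)" for m
  note a = shifted_mehler_sums[OF assms, folded a_def]
  have "b = (\<lambda>m. y * a s m - t * (if m = 0 then 0 else a (Suc s) (m - 1)))"
  proof
    fix m
    show "b m = y * a s m - t * (if m = 0 then 0 else a (Suc s) (m - 1))"
    proof (cases m)
      case (Suc k)
      have "b m = y * a s m - t ^ Suc k / qfact (Suc k) q * qint (Suc k) q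
                    * (qH (Suc k + s) x q * qH k y q)"
        unfolding b_def Suc qH_Suc[of "Suc k"] a_def by (simp add: algebra_simps)
      also have "\<dots> = y * a s m - t * a (Suc s) k"
        using qfact_Suc_cancel[of 1] by (simp add: a_def)
      finally show ?thesis by (simp add: Suc)
    qed (simp add: a_def b_def)
  qed
  then have b: "b sums (y * shifted_mehler s x y t q - t * shifted_mehler (Suc s) x y t q)"
    by (auto intro!: sums_diff sums_mult sums_shift_index a)
  have "a (Suc s) = (\<lambda>m. x * a s m - qint s q * a (s - 1) m
                          - q ^ s * t * (if m = 0 then 0 else b (m - 1)))"
  proof
    fix m
    have "qint s q * qH (m + s - 1) x q = qint s q * qH (m + (s - 1)) x q"
      by (cases s) simp_all
    moreover have "qint (m + s) q = qint s q + q ^ s * qint m q"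
      using qint_add[of s m q] by (simp add: add.commute)
    ultimately have "qint (m + s) q * qH (m + s - 1) x q
        = qint s q * qH (m + (s - 1)) x q + q ^ s * qint m q * qH (m + s - 1) x q"
      by (simp only: distrib_right)
    then have "qH (m + Suc s) x q = x * qH (m + s) x q
        - qint s q * qH (m + (s - 1)) x q - q ^ s * qint m q * qH (m + s - 1) x q"
      using qH_Suc[of "m + s" x q] by simp
    then have "a (Suc s) m = x * a s m - qint s q * a (s - 1) m
        - q ^ s * (t ^ m / qfact m q * qint m q * (qH (m + s - 1) x q * qH m y q))"
    proof -
      define c where "c = t ^ m / qfact m q"
      assume "qH (m + Suc s) x q = x * qH (m + s) x q
        - qint s q * qH (m + (s - 1)) x q - q ^ s * qint m q * qH (m + s - 1) x q"
      then show ?thesis unfolding a_def c_def[symmetric] by (simp only:) (simp add: algebra_simps)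
    qed
    also have "t ^ m / qfact m q * qint m q * (qH (m + s - 1) x q * qH m y q)
        = t * (if m = 0 then 0 else b (m - 1))"
      using qfact_Suc_cancel[of 1] by (cases m) (simp_all add: b_def)
    finally show "a (Suc s) m = x * a s m - qint s q * a (s - 1) m
                          - q ^ s * t * (if m = 0 then 0 else b (m - 1))"
      by (simp only: mult.assoc)
  qed
  then have "a (Suc s) sums (x * shifted_mehler s x y t q - qint s q * shifted_mehler (s - 1) x y t q
      - q ^ s * t * (y * shifted_mehler s x y t q - t * shifted_mehler (Suc s) x y t q))"
    by (simp only:) (intro sums_diff sums_mult sums_shift_index a b)
  from sums_unique2[OF this a] show ?thesis
    by (simp add: algebra_simps power2_eq_square)
qed

text \<open>
  Both sides obey the same recurrence in \<open>s\<close> and agree at \<open>s = 0\<close>; the factor \<open>1 - t\<^sup>2 q\<^sup>s\<close> accounts for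
  the denominator.
\<close>

lemma shifted_mehler_eq:
  assumes "x \<in> Sq q" "y \<in> Sq q" "\<bar>t\<bar> < 1"
  shows "shifted_mehler s x y t q = mehler x y t q * ASC s x y t q / qpoch (t\<^sup>2) q s"
proof (induction s rule: less_induct)
  case (less s)
  have t2: "\<bar>t\<^sup>2\<bar> < 1" using assms by (simp add: abs_square_less_1)
  have nz: "1 - t\<^sup>2 * q ^ n \<noteq> 0" for n using one_minus_pos[OF t2 q_abs, of n] by simp
  have pnz: "qpoch (t\<^sup>2) q n \<noteq> 0" for n using qpoch_pos[OF t2 q_abs, of n] by simp
  show ?case
  proof (cases s)
    case (Suc k)
    define M where "M = mehler x y t q"
    have "qint k q * shifted_mehler (k - 1) x y t q
        = M * ((1 - t\<^sup>2 * q ^ (k - 1)) * qint k q * ASC (k - 1) x y t q) / qpoch (t\<^sup>2) q k"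
      using less[of "k - 1"] nz[of "k - 1"] pnz[of "k - 1"] Suc
      by (cases k) (simp_all add: M_def qpoch_Suc)
    moreover have "shifted_mehler k x y t q = M * ASC k x y t q / qpoch (t\<^sup>2) q k"
      using less[of k] Suc by (simp add: M_def)
    ultimately have "(1 - t\<^sup>2 * q ^ k) * shifted_mehler (Suc k) x y t q
        = M * ASC (Suc k) x y t q / qpoch (t\<^sup>2) q k"
      unfolding shifted_mehler_Suc[OF assms] ASC_Suc[of k]
      by (simp add: algebra_simps diff_divide_distrib add_divide_distrib)
    then show ?thesis
      using nz[of k] pnz[of k] by (simp add: Suc M_def qpoch_Suc field_simps)
  qed simp
qed

text \<open>
  The series is the \<open>q\<close>-derivative of \<open>M(x, y; t)\<close> in \<open>t\<close>. Expanding \<open>H\<^bsub>m+1\<^esub>(x)\<close> writes it as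
  \<open>x A\<^sub>1(y, x; t) - t A\<^sub>2(y, x; t)\<close>, and both shifted series are known multiples of \<open>M\<close>.
\<close>

lemma mehler_qderiv_sums:
  assumes xy: "x \<in> Sq q" "y \<in> Sq q" and t: "\<bar>t\<bar> < 1"
  shows "(\<lambda>m. t ^ m / qfact m q * (qH (Suc m) x q * qH (Suc m) y q)) sums
    (mehler x y t q * (x * (y - t * x) / (1 - t\<^sup>2)
      - t * ((y - q * t * x) * (y - t * x) - (1 - t\<^sup>2)) / ((1 - t\<^sup>2) * (1 - q * t\<^sup>2))))"
proof -
  define a where "a s m = t ^ m / qfact m q * (qH (m + s) y q * qH m x q)" for s m
  note a = shifted_mehler_sums[OF xy(2,1) t, folded a_def]
  have "(\<lambda>m. t ^ m / qfact m q * (qH (Suc m) x q * qH (Suc m) y q))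
      = (\<lambda>m. x * a 1 m - t * (if m = 0 then 0 else a 2 (m - 1)))"
  proof
    fix m
    show "t ^ m / qfact m q * (qH (Suc m) x q * qH (Suc m) y q)
        = x * a 1 m - t * (if m = 0 then 0 else a 2 (m - 1))"
    proof (cases m)
      case (Suc k)
      have "t ^ m / qfact m q * (qH (Suc m) x q * qH (Suc m) y q)
          = x * a 1 m - t ^ Suc k / qfact (Suc k) q * qint (Suc k) q
                          * (qH (k + 2) y q * qH k x q)"
        unfolding Suc qH_Suc[of "Suc k" x] a_def by (simp add: algebra_simps)
      also have "\<dots> = x * a 1 m - t * a 2 k"
        using qfact_Suc_cancel[of 1] by (simp add: a_def)
      finally show ?thesis by (simp add: Suc)
    qed (simp add: a_def)
  qed
  then have "(\<lambda>m. t ^ m / qfact m q * (qH (Suc m) x q * qH (Suc m) y q)) sums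
      (x * shifted_mehler 1 y x t q - t * shifted_mehler 2 y x t q)"
    by (simp only:) (intro sums_diff sums_mult sums_shift_index a)
  also have "x * shifted_mehler 1 y x t q - t * shifted_mehler 2 y x t q
      = mehler x y t q * (x * (y - t * x) / (1 - t\<^sup>2)
      - t * ((y - q * t * x) * (y - t * x) - (1 - t\<^sup>2)) / ((1 - t\<^sup>2) * (1 - q * t\<^sup>2)))"
  proof -
    have "shifted_mehler 1 y x t q = mehler x y t q * (y - t * x) / (1 - t\<^sup>2)"
      using shifted_mehler_eq[OF xy(2,1) t, of 1] by (simp add: mehler_sym[of y] qpoch_def)
    moreover have "shifted_mehler 2 y x t q = mehler x y t q *
        ((y - q * t * x) * (y - t * x) - (1 - t\<^sup>2)) / ((1 - t\<^sup>2) * (1 - q * t\<^sup>2))"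
      using shifted_mehler_eq[OF xy(2,1) t, of 2]
      by (simp add: mehler_sym[of y] qpoch_def numeral_2_eq_2 mult_ac)
    ultimately show ?thesis by (simp add: algebra_simps)
  qed
  finally show ?thesis .
qed

lemma mehler_power_series:
  "mehler x y t q = (\<Sum>m. qH m x q * qH m y q / qfact m q * t ^ m)"
  by (simp add: shifted_mehler_def mult_ac)

text \<open>
  \<open>M(t) - M(q t)\<close> is \<open>(1 - q) t\<close> times the \<open>q\<close>-derivative; clearing denominators produces exactly \<open>v0\<close>.
\<close>

lemma mehler_functional_equation:
  assumes xy: "x \<in> Sq q" "y \<in> Sq q" and t: "\<bar>t\<bar> < 1"
  shows "v0 x y t q * mehler x y t q = (1 - t\<^sup>2) * (1 - q * t\<^sup>2) * mehler x y (t * q) q"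
proof -
  have tq: "\<bar>t * q\<bar> < 1"
    using mult_left_le[OF q_abs abs_ge_zero, of t] t unfolding abs_mult by linarith
  define d where "d m = t ^ m / qfact m q * (qH (Suc m) x q * qH (Suc m) y q)" for m
  define R where "R = x * (y - t * x) / (1 - t\<^sup>2)
      - t * ((y - q * t * x) * (y - t * x) - (1 - t\<^sup>2)) / ((1 - t\<^sup>2) * (1 - q * t\<^sup>2))"
  have "(\<lambda>m. t ^ m / qfact m q * (qH (m + 0) x q * qH m y q)
            - (t * q) ^ m / qfact m q * (qH (m + 0) x q * qH m y q)) sums
        (mehler x y t q - mehler x y (t * q) q)"
    by (intro sums_diff shifted_mehler_sums xy t tq)
  also have "(\<lambda>m. t ^ m / qfact m q * (qH (m + 0) x q * qH m y q)
            - (t * q) ^ m / qfact m q * (qH (m + 0) x q * qH m y q))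
        = (\<lambda>m. (1 - q) * t * (if m = 0 then 0 else d (m - 1)))"
  proof
    fix m
    have "t ^ m / qfact m q * (qH (m + 0) x q * qH m y q)
            - (t * q) ^ m / qfact m q * (qH (m + 0) x q * qH m y q)
        = (1 - q ^ m) * (t ^ m / qfact m q * (qH m x q * qH m y q))"
      by (simp add: power_mult_distrib algebra_simps diff_divide_distrib)
    also have "\<dots> = (1 - q) * (t ^ m / qfact m q * qint m q * (qH m x q * qH m y q))"
      by (simp flip: qint_closed)
    also have "\<dots> = (1 - q) * t * (if m = 0 then 0 else d (m - 1))"
      using qfact_Suc_cancel[of 1] by (cases m) (simp_all add: d_def)
    finally show "t ^ m / qfact m q * (qH (m + 0) x q * qH m y q)
            - (t * q) ^ m / qfact m q * (qH (m + 0) x q * qH m y q)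
        = (1 - q) * t * (if m = 0 then 0 else d (m - 1))" .
  qed
  finally have "(\<lambda>m. (1 - q) * t * (if m = 0 then 0 else d (m - 1))) sums
        (mehler x y t q - mehler x y (t * q) q)" .
  moreover have "d sums (mehler x y t q * R)"
    unfolding d_def R_def by (rule mehler_qderiv_sums[OF xy t])
  then have "(\<lambda>m. (1 - q) * t * (if m = 0 then 0 else d (m - 1))) sums
        ((1 - q) * t * (mehler x y t q * R))"
    by (intro sums_mult sums_shift_index)
  ultimately have "mehler x y t q - mehler x y (t * q) q = (1 - q) * t * (mehler x y t q * R)"
    by (rule sums_unique2)
  then have M: "mehler x y (t * q) q = mehler x y t q * (1 - (1 - q) * t * R)"
    by (simp add: algebra_simps)
  have t2: "\<bar>t\<^sup>2\<bar> < 1" using t by (simp add: abs_square_less_1)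
  have nz: "1 - t\<^sup>2 \<noteq> 0" "1 - q * t\<^sup>2 \<noteq> 0"
    using one_minus_pos[OF t2 q_abs, of 0] one_minus_pos[OF t2 q_abs, of 1] by (simp_all add: mult.commute)
  have R: "(1 - t\<^sup>2) * (1 - q * t\<^sup>2) * R
      = x * (y - t * x) * (1 - q * t\<^sup>2) - t * ((y - q * t * x) * (y - t * x) - (1 - t\<^sup>2))"
  proof -
    have "A * B * (u / A - w / (A * B)) = u * B - w" if "A \<noteq> 0" "B \<noteq> 0" for A B u w :: real
      using that by (simp add: right_diff_distrib)
    then show ?thesis unfolding R_def using nz by blast
  qed
  have "(1 - t\<^sup>2) * (1 - q * t\<^sup>2) * (1 - (1 - q) * t * R)
      = (1 - t\<^sup>2) * (1 - q * t\<^sup>2) - (1 - q) * t * ((1 - t\<^sup>2) * (1 - q * t\<^sup>2) * R)"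
    by (simp add: algebra_simps)
  also have "\<dots> = v0 x y t q"
    unfolding R v0_def by (simp add: algebra_simps power2_eq_square)
  finally have V: "v0 x y t q = (1 - t\<^sup>2) * (1 - q * t\<^sup>2) * (1 - (1 - q) * t * R)" ..
  show ?thesis unfolding M V by simp
qed

text \<open>
  With \<open>X = sqrt (1 - q) x\<close> and \<open>Y = sqrt (1 - q) y\<close> in \<open>[-2, 2]\<close>, completing the square gives
  \<open>4 v0 = (2 t X - (1 + t\<^sup>2) Y)\<^sup>2 + (1 - t\<^sup>2)\<^sup>2 (4 - Y\<^sup>2)\<close>. Both terms vanish only if
  \<open>|Y| = 2\<close> and \<open>|t X| = 1 + t\<^sup>2 > 2 |t|\<close>, against \<open>|X| \<le> 2\<close>.
\<close>

lemma v0_pos: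
  assumes xy: "x \<in> Sq q" "y \<in> Sq q" and t: "\<bar>t\<bar> < 1" and q1: "q \<noteq> 1"
  shows "v0 x y t q > 0"
proof -
  have pos: "0 < 1 - q" using q q1 by auto
  define X where "X = sqrt (1 - q) * x"
  define Y where "Y = sqrt (1 - q) * y"
  have XY: "\<bar>X\<bar> \<le> 2" "\<bar>Y\<bar> \<le> 2"
    using xy q1 pos by (auto simp: Sq_def X_def Y_def abs_mult field_simps abs_le_iff)
  have sq: "sqrt (1 - q) * sqrt (1 - q) = 1 - q" using pos by simp
  have v: "4 * v0 x y t q = (2 * t * X - (1 + t\<^sup>2) * Y)\<^sup>2 + (1 - t\<^sup>2)\<^sup>2 * (4 - Y\<^sup>2)"
  proof -
    have "X * Y = (sqrt (1 - q) * sqrt (1 - q)) * x * y"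
      "X\<^sup>2 = (sqrt (1 - q) * sqrt (1 - q)) * x\<^sup>2" "Y\<^sup>2 = (sqrt (1 - q) * sqrt (1 - q)) * y\<^sup>2"
      by (simp_all only: X_def Y_def power2_eq_square mult_ac)
    then have "(1 - q) * x * y = X * Y" "(1 - q) * x\<^sup>2 = X\<^sup>2" "(1 - q) * y\<^sup>2 = Y\<^sup>2"
      unfolding sq by simp_all
    moreover have "v0 x y t q = (1 - t\<^sup>2)\<^sup>2 - t * (1 + t\<^sup>2) * ((1 - q) * x * y)
        + t\<^sup>2 * ((1 - q) * x\<^sup>2 + (1 - q) * y\<^sup>2)"
      by (simp add: v0_def algebra_simps)
    ultimately have "v0 x y t q = (1 - t\<^sup>2)\<^sup>2 - t * (1 + t\<^sup>2) * (X * Y) + t\<^sup>2 * (X\<^sup>2 + Y\<^sup>2)"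
      by simp
    then show ?thesis by (simp add: algebra_simps power2_eq_square)
  qed
  have t2: "t\<^sup>2 < 1" using t by (simp add: abs_square_less_1)
  have Y4: "Y\<^sup>2 \<le> 4" using XY(2) power_mono[of "\<bar>Y\<bar>" 2 2] by simp
  show ?thesis
  proof (cases "Y\<^sup>2 = 4")
    case False
    then have "(1 - t\<^sup>2)\<^sup>2 * (4 - Y\<^sup>2) > 0" using Y4 t2 by (intro mult_pos_pos) auto
    moreover have "(2 * t * X - (1 + t\<^sup>2) * Y)\<^sup>2 \<ge> 0" by simp
    ultimately show ?thesis using v by linarith
  next
    case True
    then have "\<bar>Y\<bar>\<^sup>2 = 2\<^sup>2" by simp
    then have Y2: "\<bar>Y\<bar> = 2" by (rule power2_eq_imp_eq) auto
    have "\<bar>2 * t * X\<bar> \<le> 4 * \<bar>t\<bar>"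
      using mult_left_mono[OF XY(1), of "2 * \<bar>t\<bar>"] by (simp add: abs_mult)
    also have "\<dots> < 2 * (1 + t\<^sup>2)"
    proof -
      have "(1 - \<bar>t\<bar>)\<^sup>2 > 0" using t by simp
      then show ?thesis by (simp add: power2_eq_square algebra_simps)
    qed
    also have "\<dots> = \<bar>(1 + t\<^sup>2) * Y\<bar>" using Y2 by (simp add: abs_mult)
    finally have "2 * t * X - (1 + t\<^sup>2) * Y \<noteq> 0" by auto
    then have "(2 * t * X - (1 + t\<^sup>2) * Y)\<^sup>2 > 0" by simp
    moreover have "4 * v0 x y t q = (2 * t * X - (1 + t\<^sup>2) * Y)\<^sup>2" using v True by simp
    ultimately show ?thesis by linarith
  qed
qed


lemma mehler_at_zero: "mehler x y 0 q = 1"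
proof -
  have "(\<lambda>m. 0 ^ m / qfact m q * (qH (m + 0) x q * qH m y q)) sums
        (\<Sum>m\<in>{0}. 0 ^ m / qfact m q * (qH (m + 0) x q * qH m y q))"
    by (rule sums_finite) auto
  then show ?thesis by (simp add: shifted_mehler_def sums_iff)
qed

text \<open>
  Iterating the functional equation \<open>n\<close> times leaves \<open>M(t q\<^sup>n)\<close>, which tends to \<open>M(0) = 1\<close>, next to partial products of the
  claimed infinite products.
\<close>

lemma mehler_closed_form_q:
  assumes xy: "x \<in> Sq q" "y \<in> Sq q" and t: "\<bar>t\<bar> < 1" and q1: "q \<noteq> 1"
  shows "mehler x y t q = f_CN_over_f_N x y t q" and "mehler x y t q \<noteq> 0"
proof -
  have q': "\<bar>q\<bar> < 1" using q q1 by auto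
  have t2: "\<bar>t\<^sup>2\<bar> < 1" using t by (simp add: abs_square_less_1)
  have tq: "\<bar>t * q ^ n\<bar> < 1" for n
  proof -
    have "\<bar>t\<bar> * \<bar>q\<bar> ^ n \<le> \<bar>t\<bar>" using q' by (simp add: mult_left_le power_le_one)
    then show ?thesis using t by (simp add: abs_mult power_abs)
  qed
  define v where "v k = v0 x y (t * q ^ k) q" for k
  have v: "v k > 0" for k unfolding v_def by (rule v0_pos[OF xy tq q1])
  have iter: "mehler x y t q
      = mehler x y (t * q ^ n) q * qpoch (t\<^sup>2) q (2 * n) * (\<Prod>k<n. 1 / v k)" for n
  proof (induction n)
    case (Suc n)
    have "v n * mehler x y (t * q ^ n) q
        = (1 - (t * q ^ n)\<^sup>2) * (1 - q * (t * q ^ n)\<^sup>2) * mehler x y (t * q ^ n * q) q"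
      unfolding v_def by (rule mehler_functional_equation[OF xy tq])
    also have "(1 - (t * q ^ n)\<^sup>2) * (1 - q * (t * q ^ n)\<^sup>2)
        = (1 - t\<^sup>2 * q ^ (2 * n)) * (1 - t\<^sup>2 * q ^ Suc (2 * n))"
      by (simp add: power_mult_distrib power_mult[symmetric] mult_ac)
    finally have "mehler x y (t * q ^ n) q = (1 - t\<^sup>2 * q ^ (2 * n)) * (1 - t\<^sup>2 * q ^ Suc (2 * n))
        * mehler x y (t * q ^ Suc n) q * (1 / v n)"
      using v[of n] by (simp add: field_simps)
    then show ?case
      unfolding Suc[THEN trans] by (subst Suc) (simp add: qpoch_Suc mult_ac)
  qed simp
  have "(\<lambda>n. mehler x y (t * q ^ n) q) \<longlonglongrightarrow> mehler x y 0 q"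
  proof -
    have "summable (\<lambda>m. qH m x q * qH m y q / qfact m q * (1/2) ^ m)"
      using shifted_mehler_summable[OF xy, of "1/2" 0] by (simp add: mult_ac)
    from isCont_powser[OF this, of 0] have "isCont (\<lambda>t. mehler x y t q) 0"
      by (simp add: mehler_power_series[abs_def])
    moreover have "(\<lambda>n. t * q ^ n) \<longlonglongrightarrow> t * 0"
      by (intro tendsto_intros LIMSEQ_power_zero) (use q' in auto)
    ultimately show ?thesis by (auto intro: isCont_tendsto_compose)
  qed
  moreover have "(\<lambda>n. qpoch (t\<^sup>2) q (2 * n)) \<longlonglongrightarrow> qpoch_inf (t\<^sup>2) q"
    by (rule filterlim_compose[OF qpoch_limit(1)[OF q' t2]])
       (auto intro!: filterlim_subseq simp: strict_mono_def)
  moreover have cv: "convergent_prod v"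
  proof -
    define B where "B = 3 + 2 * \<bar>(1 - q) * x * y\<bar> + (1 - q) * (x\<^sup>2 + y\<^sup>2)"
    have "norm (norm (v k - 1)) \<le> B * \<bar>q\<bar> ^ k" for k
    proof -
      define s where "s = t * q ^ k"
      have s: "\<bar>s\<bar> < 1" using tq[of k] by (simp add: s_def)
      have s2: "s\<^sup>2 < 1" using s by (simp add: abs_square_less_1)
      have "v k - 1 = s * (s * (s\<^sup>2 - 2) - (1 + s\<^sup>2) * ((1 - q) * x * y) + s * ((1 - q) * (x\<^sup>2 + y\<^sup>2)))"
        unfolding v_def s_def[symmetric] v0_def by (simp add: power2_eq_square algebra_simps)
      also have "\<bar>\<dots>\<bar> \<le> \<bar>s\<bar> * B"
        unfolding abs_mult[of s "_ - _ + _"]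
      proof (rule mult_left_mono)
        have "\<bar>s * (s\<^sup>2 - 2)\<bar> \<le> 1 * 3"
          unfolding abs_mult using s s2 zero_le_power2[of s] by (intro mult_mono) linarith+
        moreover have "\<bar>(1 + s\<^sup>2) * ((1 - q) * x * y)\<bar> \<le> 2 * \<bar>(1 - q) * x * y\<bar>"
          unfolding abs_mult[of "1 + s\<^sup>2"] using s2 zero_le_power2[of s]
          by (intro mult_right_mono) linarith+
        moreover have "\<bar>s * ((1 - q) * (x\<^sup>2 + y\<^sup>2))\<bar> \<le> 1 * ((1 - q) * (x\<^sup>2 + y\<^sup>2))"
          unfolding abs_mult using s q' by (intro mult_mono) auto
        ultimately show "\<bar>s * (s\<^sup>2 - 2) - (1 + s\<^sup>2) * ((1 - q) * x * y) + s * ((1 - q) * (x\<^sup>2 + y\<^sup>2))\<bar> \<le> B"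
          unfolding B_def by linarith
      qed simp
      also have "\<dots> \<le> \<bar>q\<bar> ^ k * B"
        using t q' by (intro mult_right_mono) (auto simp: s_def B_def abs_mult power_abs mult_left_le_one_le)
      finally show ?thesis by (simp add: mult.commute)
    qed
    then have "summable (\<lambda>k. norm (v k - 1))"
      using q' by (intro summable_comparison_test'
          [OF summable_mult[OF summable_geometric[of "\<bar>q\<bar>"], of B]]) auto
    then show ?thesis
      by (intro abs_convergent_prod_imp_convergent_prod summable_imp_abs_convergent_prod)
  qed
  then have cv': "convergent_prod (\<lambda>k. 1 / v k)"
    using convergent_prod_inverse[OF cv] by (simp add: inverse_eq_divide)
  then have "(\<lambda>n. \<Prod>k<n. 1 / v k) \<longlonglongrightarrow> (\<Prod>k. 1 / v k)"
    by (intro has_prod_imp_tendsto' convergent_prod_has_prod)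
  ultimately have "(\<lambda>n. mehler x y (t * q ^ n) q * qpoch (t\<^sup>2) q (2 * n) * (\<Prod>k<n. 1 / v k))
      \<longlonglongrightarrow> mehler x y 0 q * qpoch_inf (t\<^sup>2) q * (\<Prod>k. 1 / v k)"
    by (intro tendsto_mult)
  then have "(\<lambda>n. mehler x y t q) \<longlonglongrightarrow> qpoch_inf (t\<^sup>2) q * (\<Prod>k. 1 / v k)"
    by (simp only: iter[symmetric]) (simp add: mehler_at_zero)
  then have eq: "mehler x y t q = qpoch_inf (t\<^sup>2) q * (\<Prod>k. 1 / v k)"
    by (simp add: LIMSEQ_const_iff)
  then show "mehler x y t q = f_CN_over_f_N x y t q"
    using q1 by (simp add: f_CN_over_f_N_def v_def)
  have "(\<Prod>k. 1 / v k) \<noteq> 0"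
    using cv' v by (intro prodinf_nonzero) (auto simp: less_le)
  then show "mehler x y t q \<noteq> 0"
    using eq qpoch_limit(2)[OF q' t2] by simp
qed

end

text \<open>
  For \<open>q = 1\<close> the \<open>q\<close>-derivative is the derivative, so \<open>mehler_qderiv_sums\<close> is a linear differential equation. The function
  \<open>L\<close> is \<open>M\<close> divided by the claimed closed form, and its derivative vanishes on \<open>(-1, 1)\<close>.
\<close>

lemma mehler_closed_form_1:
  assumes t: "\<bar>t\<bar> < 1"
  shows "mehler x y t 1 = f_CN_over_f_N x y t 1"
proof -
  define M where "M s = mehler x y s 1" for s
  define c where "c m = qH m x 1 * qH m y 1 / qfact m 1" for m
  define L where "L s = M s * (sqrt (1 - s\<^sup>2) * exp ((x - s * y)\<^sup>2 / (2 * (1 - s\<^sup>2)) - x\<^sup>2 / 2))" for s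
  have S: "x \<in> Sq 1" "y \<in> Sq 1" by (simp_all add: Sq_def)
  have "DERIV L s :> 0" if s: "s \<in> {-1<..<1}" for s
  proof -
    \<comment> \<open>Termwise differentiation at \<open>s\<close> needs convergence at a point farther from \<open>0\<close>.\<close>
    define K where "K = (1 + \<bar>s\<bar>) / 2"
    have K: "\<bar>K\<bar> < 1" "\<bar>s\<bar> < \<bar>K\<bar>" using s by (auto simp: K_def)
    have "summable (\<lambda>m. c m * K ^ m)"
      using shifted_mehler_summable[of 1, OF _ _ S K(1), of 0] by (simp add: c_def mult_ac)
    from termdiffs_strong[OF this, of s] K
    have "DERIV (\<lambda>s. \<Sum>m. c m * s ^ m) s :> (\<Sum>m. diffs c m * s ^ m)" by simp
    moreover have "(\<lambda>s. \<Sum>m. c m * s ^ m) = M"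
      by (simp add: M_def[abs_def] mehler_power_series c_def)
    moreover have "diffs c m * s ^ m = s ^ m / qfact m 1 * (qH (Suc m) x 1 * qH (Suc m) y 1)" for m
      by (simp add: diffs_def c_def qfact_one del: qH.simps of_nat_Suc)
    ultimately have D: "DERIV M s :> M s * (x * (y - s * x) / (1 - s\<^sup>2)
      - s * ((y - 1 * s * x) * (y - s * x) - (1 - s\<^sup>2)) / ((1 - s\<^sup>2) * (1 - 1 * s\<^sup>2)))"
      using mehler_qderiv_sums[of 1, OF _ _ S, of s] s
      by (simp add: sums_iff M_def abs_less_iff)
    define w where "w = 1 - s\<^sup>2"
    have "s\<^sup>2 < 1" using s by (auto simp: abs_square_less_1 abs_less_iff)
    then have w: "w > 0" by (simp add: w_def)
    define E where "E = exp ((x - s * y)\<^sup>2 / (2 * w) - x\<^sup>2 / 2)"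
    define R where "R = x * (y - s * x) / w - s * ((y - s * x) * (y - s * x) - w) / (w * w)"
    have D': "DERIV M s :> M s * R" using D by (simp add: R_def w_def)
    have d1: "DERIV (\<lambda>s. sqrt (1 - s\<^sup>2)) s :> - s / sqrt w"
    proof -
      have "DERIV (\<lambda>s. 1 - s\<^sup>2) s :> - (2 * s)" by (auto intro!: derivative_eq_intros)
      from DERIV_chain2[OF DERIV_real_sqrt this] w show ?thesis by (simp add: w_def field_simps)
    qed
    have d2: "DERIV (\<lambda>s. (x - s * y)\<^sup>2 / (2 * (1 - s\<^sup>2)) - x\<^sup>2 / 2) s :>
        (2 * (x - s * y) * (- y) * (2 * w) - (x - s * y)\<^sup>2 * (2 * (- (2 * s)))) / (2 * w)\<^sup>2"
    proof -
      have "DERIV (\<lambda>s. (x - s * y)\<^sup>2) s :> 2 * (x - s * y) * (- y)"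
        "DERIV (\<lambda>s. 2 * (1 - s\<^sup>2)) s :> 2 * (- (2 * s))"
        by (auto intro!: derivative_eq_intros)
      from DERIV_diff[OF DERIV_divide[OF this] DERIV_const[of "x\<^sup>2 / 2"]] w
      show ?thesis by (simp add: w_def power2_eq_square)
    qed
    have d3: "DERIV (\<lambda>s. exp ((x - s * y)\<^sup>2 / (2 * (1 - s\<^sup>2)) - x\<^sup>2 / 2)) s :> E *
        ((2 * (x - s * y) * (- y) * (2 * w) - (x - s * y)\<^sup>2 * (2 * (- (2 * s)))) / (2 * w)\<^sup>2)"
      using DERIV_fun_exp[OF d2] by (simp add: E_def w_def)
    have "DERIV L s :> M s * R * (sqrt w * E) + M s * ((- s / sqrt w) * E
        + sqrt w * (E * ((2 * (x - s * y) * (- y) * (2 * w) - (x - s * y)\<^sup>2 * (2 * (- (2 * s)))) / (2 * w)\<^sup>2)))"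
      unfolding L_def[abs_def]
      by (rule DERIV_cong[OF DERIV_mult[OF D' DERIV_mult[OF d1 d3]]])
         (simp add: E_def w_def mult_ac add_ac)
    also have "M s * R * (sqrt w * E) + M s * ((- s / sqrt w) * E
        + sqrt w * (E * ((2 * (x - s * y) * (- y) * (2 * w) - (x - s * y)\<^sup>2 * (2 * (- (2 * s)))) / (2 * w)\<^sup>2)))
        = M s * E * sqrt w * (R - s / w - y * (x - s * y) / w + s * (x - s * y)\<^sup>2 / w\<^sup>2)"
    proof -
      have e1: "- s / sqrt w = sqrt w * - (s / w)" using w by (simp add: field_simps)
      have e2: "(2 * (x - s * y) * (- y) * (2 * w) - (x - s * y)\<^sup>2 * (2 * (- (2 * s)))) / (2 * w)\<^sup>2
          = - (y * (x - s * y) / w) + s * (x - s * y)\<^sup>2 / w\<^sup>2"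
        using w by (simp add: field_simps power2_eq_square)
      have "m * R * (k * E) + m * (k * - a * E + k * (E * (- b + c))) = m * E * k * (R - a - b + c)"
        for m R k E a b c :: real by (simp add: algebra_simps)
      then show ?thesis unfolding e1 e2 .
    qed
    also have "R - s / w - y * (x - s * y) / w + s * (x - s * y)\<^sup>2 / w\<^sup>2
        = (w * (x * (y - s * x)) - s * ((y - s * x) * (y - s * x) - w) - s * w
             - y * (x - s * y) * w + s * (x - s * y)\<^sup>2) / w\<^sup>2"
      using w unfolding R_def by (simp add: divide_simps power2_eq_square)
    also have "w * (x * (y - s * x)) - s * ((y - s * x) * (y - s * x) - w) - s * w
             - y * (x - s * y) * w + s * (x - s * y)\<^sup>2 = 0"
      unfolding w_def by (simp add: algebra_simps power2_eq_square)
    finally show ?thesis by simp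
  qed
  then have "L t = L 0"
    by (rule DERIV_isconst3[of "-1" 1, rotated 3]) (use t in auto)
  moreover have "L 0 = 1"
    by (simp add: L_def M_def mehler_at_zero)
  ultimately have "M t * (sqrt (1 - t\<^sup>2) * exp ((x - t * y)\<^sup>2 / (2 * (1 - t\<^sup>2)) - x\<^sup>2 / 2)) = 1"
    by (simp add: L_def)
  moreover have w: "1 - t\<^sup>2 > 0" using t by (simp add: abs_square_less_1)
  ultimately have Mt: "M t = exp (x\<^sup>2 / 2 - (x - t * y)\<^sup>2 / (2 * (1 - t\<^sup>2))) / sqrt (1 - t\<^sup>2)"
  proof -
    define a where "a = (x - t * y)\<^sup>2 / (2 * (1 - t\<^sup>2))"
    have "sqrt (1 - t\<^sup>2) > 0" using w by simp
    with \<open>M t * (sqrt (1 - t\<^sup>2) * exp ((x - t * y)\<^sup>2 / (2 * (1 - t\<^sup>2)) - x\<^sup>2 / 2)) = 1\<close>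
    have "M t = inverse (exp (a - x\<^sup>2 / 2)) / sqrt (1 - t\<^sup>2)"
      unfolding a_def[symmetric] by (simp add: divide_simps mult_ac del: exp_diff)
    also have "inverse (exp (a - x\<^sup>2 / 2)) = exp (x\<^sup>2 / 2 - a)"
      by (simp flip: exp_minus)
    finally show ?thesis by (simp add: a_def)
  qed
  also have "\<dots> = f_CN_over_f_N x y t 1"
  proof -
    define a where "a = (x - t * y)\<^sup>2 / (2 * (1 - t\<^sup>2))"
    define v where "v = 1 - t\<^sup>2"
    have v: "v > 0" using w by (simp add: v_def)
    have "(sqrt v)\<^sup>2 = v" using v by simp
    then have "f_CN_over_f_N x y t 1
        = (1 / sqrt (2 * pi * v) * exp (- a)) / (1 / sqrt (2 * pi) * exp (- (x\<^sup>2 / 2)))"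
      unfolding f_CN_over_f_N_def normal_density_def v_def[symmetric] a_def by simp
    also have "\<dots> = exp (x\<^sup>2 / 2) * exp (- a) / sqrt v"
      using v by (simp add: real_sqrt_mult exp_minus[of "x\<^sup>2 / 2"] field_simps)
    also have "exp (x\<^sup>2 / 2) * exp (- a) = exp (x\<^sup>2 / 2 - a)"
      by (simp flip: exp_add)
    finally show ?thesis by (simp add: a_def v_def)
  qed
  finally show ?thesis by (simp add: M_def)
qed

lemma mehler_closed_form:
  assumes q: "-1 < q" "q \<le> 1" and "x \<in> Sq q" "y \<in> Sq q" "\<bar>t\<bar> < 1"
  shows "mehler x y t q = f_CN_over_f_N x y t q" and "mehler x y t q \<noteq> 0"
proof -
  show "mehler x y t q = f_CN_over_f_N x y t q"
    using mehler_closed_form_q(1)[OF assms] mehler_closed_form_1[OF assms(5)] by (cases "q = 1") auto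
  then show "mehler x y t q \<noteq> 0"
  proof (cases "q = 1")
    case True
    have "1 - t\<^sup>2 > 0" using assms by (simp add: abs_square_less_1)
    then have "f_CN_over_f_N x y t 1 \<noteq> 0"
      by (simp add: f_CN_over_f_N_def normal_density_def)
    then show ?thesis using mehler_closed_form_1[OF assms(5)] True by simp
  qed (use mehler_closed_form_q(2)[OF assms] in auto)
qed

section \<open>Expansions of density quotients and of the trivariate density\<close>

lemma summable_geometric_pair:
  fixes C \<theta> :: real
  assumes "0 \<le> C" "0 \<le> \<theta>" "\<theta> < 1"
  shows "((\<lambda>(s, m). C * \<theta> ^ (s + m)) has_sum (C / (1 - \<theta>) / (1 - \<theta>))) (UNIV \<times> UNIV :: (nat \<times> nat) set)"
proof (rule has_sum_SigmaI)
  have geo: "((\<lambda>m. c * \<theta> ^ m) has_sum (c / (1 - \<theta>))) UNIV" for c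
  proof -
    have "(\<lambda>m. \<theta> ^ m) sums (1 / (1 - \<theta>))" using assms by (intro geometric_sums) auto
    then have "((\<lambda>m. \<theta> ^ m) has_sum (1 / (1 - \<theta>))) UNIV"
      using assms by (intro norm_summable_imp_has_sum) (auto simp: summable_geometric)
    from has_sum_cmult_right[OF this, of c] show ?thesis by simp
  qed
  show rows: "((\<lambda>m. case (s, m) of (s, m) \<Rightarrow> C * \<theta> ^ (s + m)) has_sum (C / (1 - \<theta>) * \<theta> ^ s)) UNIV" for s
    using geo[of "C * \<theta> ^ s"] by (simp add: power_add mult_ac)
  show outer: "((\<lambda>s. C / (1 - \<theta>) * \<theta> ^ s) has_sum (C / (1 - \<theta>) / (1 - \<theta>))) UNIV"
    by (rule geo)
  show "(\<lambda>(s, m). C * \<theta> ^ (s + m)) summable_on (UNIV \<times> UNIV :: (nat \<times> nat) set)"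
    using assms by (intro summable_on_SigmaI[OF rows has_sum_imp_summable[OF outer]]) auto
qed

lemma summable_on_sums_imp_has_sum:
  fixes f :: "nat \<Rightarrow> real"
  assumes "f summable_on UNIV" "f sums T"
  shows "(f has_sum T) UNIV"
proof -
  have "(f has_sum infsum f UNIV) UNIV" using assms(1) by simp
  with sums_unique2[OF has_sum_imp_sums[OF this] assms(2)] show ?thesis by simp
qed

text \<open>
  The geometric bound makes the family summable over all pairs, so it may be summed in any order. Convergence of the two
  iterated series is part of the conclusion.
\<close>

lemma double_series_rows_diagonals:
  fixes f :: "nat \<Rightarrow> nat \<Rightarrow> real"
  assumes bound: "\<And>s m. \<bar>f s m\<bar> \<le> C * \<theta> ^ (s + m)" and \<theta>: "0 \<le> \<theta>" "\<theta> < 1"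
    and rows: "\<And>s. f s sums g s"
  obtains S where "g sums S" "(\<lambda>n. \<Sum>s\<le>n. f s (n - s)) sums S"
proof -
  have C: "0 \<le> C" using bound[of 0 0] by simp
  have "(\<lambda>p. norm (case p of (s, m) \<Rightarrow> f s m)) summable_on (UNIV \<times> UNIV)"
    by (rule Infinite_Sum.abs_summable_on_comparison_test'[OF
          has_sum_imp_summable[OF summable_geometric_pair[OF C \<theta>]]])
       (use bound in auto)
  then have summ: "(\<lambda>(s, m). f s m) summable_on (UNIV \<times> UNIV)"
    by (rule abs_summable_summable)
  then obtain S where S: "((\<lambda>(s, m). f s m) has_sum S) (UNIV \<times> UNIV)"
    by (auto simp: summable_on_def)
  have "f s summable_on UNIV" for s
    using summable_on_SigmaD1[OF summ] by simp
  then have "(f s has_sum g s) UNIV" for s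
    using rows[of s] by (rule summable_on_sums_imp_has_sum)
  then have "(g has_sum S) UNIV"
    using has_sum_SigmaD[OF S, of g] by simp
  moreover have "((\<lambda>(n, s). f s (n - s)) has_sum S) (Sigma UNIV (\<lambda>n. {..n}))"
    using S by (subst has_sum_reindex_bij_witness[where
        i = "\<lambda>(s, m). (s + m, s)" and j = "\<lambda>(n, s). (s, n - s)"]) auto
  then have "((\<lambda>n. \<Sum>s\<le>n. f s (n - s)) has_sum S) UNIV"
    by (rule has_sum_SigmaD) (auto intro!: has_sum_finite)
  ultimately show thesis by (intro that[of S]) (auto dest: has_sum_imp_sums)
qed

text \<open>
  The double series \<open>f\<close> arises from \<open>M(x, z; t)\<close> by the connection formula for \<open>H\<^sub>n(z)\<close>, so its diagonals are the terms of
  that series. Its row \<open>s\<close> is a multiple of \<open>A\<^sub>s(x, y; t \<rho>)\<close>, that is, \<open>M(x, y; t \<rho>)\<close> times the \<open>s\<close>-th term on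
  the left.
\<close>

lemma density_ratio_expansion:
  assumes q: "-1 < q" "q \<le> 1" and S: "x \<in> Sq q" "y \<in> Sq q" "z \<in> Sq q"
    and t: "\<bar>t\<bar> < 1" and \<rho>: "\<bar>\<rho>\<bar> < 1"
  shows "(\<lambda>s. t ^ s / (qfact s q * qpoch ((t * \<rho>)\<^sup>2) q s)
            * ASC s x y (t * \<rho>) q * ASC s z y \<rho> q)
        sums (mehler x z t q / mehler x y (t * \<rho>) q)"
proof -
  define f where "f s m = t ^ (s + m) * \<rho> ^ m / (qfact s q * qfact m q)
      * (ASC s z y \<rho> q * (qH (m + s) x q * qH m y q))" for s m
  define M where "M = mehler x y (t * \<rho>) q"
  have t\<rho>: "\<bar>t * \<rho>\<bar> < 1"
    using mult_left_le[of "\<bar>\<rho>\<bar>" "\<bar>t\<bar>"] t \<rho> unfolding abs_mult by linarith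
  have \<rho>2: "\<bar>\<rho>\<^sup>2\<bar> < 1" using \<rho> by (simp add: abs_square_less_1)
  obtain r where r: "r > 1" "r\<^sup>2 * \<bar>t\<bar> < 1" using exists_growth_rate[of "\<bar>t\<bar>"] t by auto
  obtain A where A: "A > 0"
    "\<And>n. \<bar>ASC n z y \<rho> q\<bar> \<le> A * r ^ n * sqrt (qfact n q * qpoch (\<rho>\<^sup>2) q n)"
    using ASC_growth[OF q \<rho> S(3) r(1)] by metis
  obtain B where B: "B > 0" "\<And>n. \<bar>qH n x q\<bar> \<le> B * r ^ n * sqrt (qfact n q)"
    using qH_growth[OF q S(1) r(1)] by metis
  obtain D where D: "D > 0" "\<And>n. \<bar>qH n y q\<bar> \<le> D * r ^ n * sqrt (qfact n q)"
    using qH_growth[OF q S(2) r(1)] by metis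
  obtain E where E: "E > 0"
    "\<And>s m. \<bar>\<rho>\<bar> ^ m * sqrt (qfact (s + m) q / (qfact s q * qfact m q) * qpoch (\<rho>\<^sup>2) q s) \<le> E"
    using connection_weight_bounded[OF q \<rho>] by metis
  have bound: "\<bar>f s m\<bar> \<le> (A * B * D * E) * (r\<^sup>2 * \<bar>t\<bar>) ^ (s + m)" for s m
  proof -
    have F: "qfact s q > 0" "qfact m q > 0" "qfact (m + s) q > 0" "qpoch (\<rho>\<^sup>2) q s > 0"
      using qfact_pos[OF q] qpoch_pos[OF \<rho>2 q_abs[OF q]] by auto
    have "\<bar>f s m\<bar> = \<bar>t\<bar> ^ (s + m) * \<bar>\<rho>\<bar> ^ m / (qfact s q * qfact m q)
        * (\<bar>ASC s z y \<rho> q\<bar> * (\<bar>qH (m + s) x q\<bar> * \<bar>qH m y q\<bar>))"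
      using F by (simp add: f_def abs_mult power_abs)
    also have "\<dots> \<le> \<bar>t\<bar> ^ (s + m) * \<bar>\<rho>\<bar> ^ m / (qfact s q * qfact m q)
        * ((A * r ^ s * sqrt (qfact s q * qpoch (\<rho>\<^sup>2) q s)) *
           ((B * r ^ (m + s) * sqrt (qfact (m + s) q)) * (D * r ^ m * sqrt (qfact m q))))"
      using F r A(1) B(1) D(1) by (intro mult_left_mono mult_mono A B D) auto
    also have "\<dots> = (A * B * D * (r\<^sup>2 * \<bar>t\<bar>) ^ (s + m)) * (\<bar>\<rho>\<bar> ^ m *
        (sqrt (qfact s q * qpoch (\<rho>\<^sup>2) q s) * sqrt (qfact (m + s) q) * sqrt (qfact m q)
          / (qfact s q * qfact m q)))"
      by (simp add: power_add power_mult_distrib power2_eq_square mult_ac)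
    also have "sqrt (qfact s q * qpoch (\<rho>\<^sup>2) q s) * sqrt (qfact (m + s) q) * sqrt (qfact m q)
          / (qfact s q * qfact m q)
        = sqrt (qfact (s + m) q / (qfact s q * qfact m q) * qpoch (\<rho>\<^sup>2) q s)"
      using F by (simp add: real_sqrt_mult real_sqrt_divide add.commute field_simps)
    also have "(A * B * D * (r\<^sup>2 * \<bar>t\<bar>) ^ (s + m)) * (\<bar>\<rho>\<bar> ^ m * \<dots>)
        \<le> (A * B * D * (r\<^sup>2 * \<bar>t\<bar>) ^ (s + m)) * E"
      using A(1) B(1) D(1) r(1) by (intro mult_left_mono E) auto
    finally show ?thesis by (simp add: mult_ac)
  qed
  have row: "f s sums (M * (t ^ s / (qfact s q * qpoch ((t * \<rho>)\<^sup>2) q s)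
            * ASC s x y (t * \<rho>) q * ASC s z y \<rho> q))" for s
  proof -
    have "f s = (\<lambda>m. t ^ s / qfact s q * ASC s z y \<rho> q *
              ((t * \<rho>) ^ m / qfact m q * (qH (m + s) x q * qH m y q)))"
      by (simp add: f_def fun_eq_iff power_add power_mult_distrib)
    also have "\<dots> sums (t ^ s / qfact s q * ASC s z y \<rho> q * shifted_mehler s x y (t * \<rho>) q)"
      by (intro sums_mult shifted_mehler_sums q S t\<rho>)
    finally show ?thesis
      unfolding shifted_mehler_eq[OF q S(1,2) t\<rho>, of s] M_def by (simp add: mult_ac)
  qed
  have diag: "(\<Sum>s\<le>n. f s (n - s)) = t ^ n / qfact n q * (qH (n + 0) x q * qH n z q)" for n
  proof -
    have "(\<Sum>s\<le>n. f s (n - s)) = t ^ n * qH n x q * (\<Sum>s\<le>n. ASC s z y \<rho> q / qfact s q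
              * (\<rho> ^ (n - s) * qH (n - s) y q / qfact (n - s) q))"
      unfolding sum_distrib_left by (rule sum.cong) (auto simp: f_def mult_ac)
    also have "\<dots> = t ^ n * qH n x q * (qH n z q / qfact n q)"
      by (simp only: qH_connection[OF q, of n z y \<rho>])
    finally show ?thesis by simp
  qed
  obtain L where L: "(\<lambda>s. M * (t ^ s / (qfact s q * qpoch ((t * \<rho>)\<^sup>2) q s)
            * ASC s x y (t * \<rho>) q * ASC s z y \<rho> q)) sums L"
    "(\<lambda>n. \<Sum>s\<le>n. f s (n - s)) sums L"
    by (rule double_series_rows_diagonals[OF bound _ r(2) row]) simp
  have "L = mehler x z t q"
    using L(2) shifted_mehler_sums[OF q S(1,3) t, of 0] unfolding diag by (rule sums_unique2)
  moreover have "M \<noteq> 0" unfolding M_def by (rule mehler_closed_form(2)[OF q S(1,2) t\<rho>])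
  ultimately show ?thesis
    using sums_divide[OF L(1), of M] by (simp add: M_def)
qed

text \<open>
  Multiplying the alternating series by \<open>M(x, z; a)\<close> turns its terms into multiples of \<open>A\<^sub>s(x, z; a)\<close>. In the resulting double series the
  diagonals are evaluated by \<open>ASC_inverse_connection\<close>, so the convergence of the series on the right is part of the result. The
  double series is dominated by a geometric one of ratio as close as desired to \<open>|a|\<close>, or to \<open>|a| / sqrt (1 - b\<^sup>2)\<close> if \<open>q = 1\<close>.
\<close>

lemma inverse_density_ratio_expansion:
  assumes q: "-1 < q" "q \<le> 1" and S: "x \<in> Sq q" "y \<in> Sq q" "z \<in> Sq q"
    and a: "\<bar>a\<bar> < 1" and b: "\<bar>b\<bar> < 1" and ab: "q = 1 \<Longrightarrow> a\<^sup>2 + b\<^sup>2 < 1"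
  shows "summable (\<lambda>k. a ^ k / (qfact k q * qpoch (b\<^sup>2) q k) * qH k x q * ASC k z y b q)"
    and "(\<lambda>s. (-1) ^ s * q ^ (s choose 2) * a ^ s * b ^ s
            / (qfact s q * (qpoch (a\<^sup>2) q s * qpoch (b\<^sup>2) q s))
            * ASC s x z a q * ASC s y z b q)
        sums (1 / mehler x z a q
          * (\<Sum>k. a ^ k / (qfact k q * qpoch (b\<^sup>2) q k) * qH k x q * ASC k z y b q))"
proof -
  define f where "f s m = (-b) ^ s * q ^ (s choose 2) * a ^ (s + m)
      / (qfact s q * qfact m q * qpoch (b\<^sup>2) q s)
      * (ASC s y z b q * (qH (m + s) x q * qH m z q))" for s m
  define M where "M = mehler x z a q"
  define \<kappa> where "\<kappa> = (if q = 1 then 1 / sqrt (1 - b\<^sup>2) else 1)"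
  have a2: "\<bar>a\<^sup>2\<bar> < 1" and b2: "\<bar>b\<^sup>2\<bar> < 1" using a b by (simp_all add: abs_square_less_1)
  have \<kappa>: "\<kappa> > 0" "\<bar>a\<bar> * \<kappa> < 1"
  proof -
    have "\<bar>a\<bar> < sqrt (1 - b\<^sup>2)" if "q = 1"
      using ab[OF that] by (intro real_less_rsqrt) auto
    then show "\<kappa> > 0" "\<bar>a\<bar> * \<kappa> < 1" using a b2 by (auto simp: \<kappa>_def divide_less_eq)
  qed
  obtain r where r: "r > 1" "r\<^sup>2 * (\<bar>a\<bar> * \<kappa>) < 1"
    using exists_growth_rate[of "\<bar>a\<bar> * \<kappa>"] \<kappa> by auto
  obtain A where A: "A > 0"
    "\<And>n. \<bar>ASC n y z b q\<bar> \<le> A * r ^ n * sqrt (qfact n q * qpoch (b\<^sup>2) q n)"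
    using ASC_growth[OF q b S(2) r(1)] by metis
  obtain B where B: "B > 0" "\<And>n. \<bar>qH n x q\<bar> \<le> B * r ^ n * sqrt (qfact n q)"
    using qH_growth[OF q S(1) r(1)] by metis
  obtain D where D: "D > 0" "\<And>n. \<bar>qH n z q\<bar> \<le> D * r ^ n * sqrt (qfact n q)"
    using qH_growth[OF q S(3) r(1)] by metis
  obtain E where E: "E > 0"
    "\<And>s m. \<bar>b\<bar> ^ s * sqrt (qfact (s + m) q / (qfact s q * qfact m q) / qpoch (b\<^sup>2) q s)
        \<le> E * \<kappa> ^ (s + m)"
    using inverse_connection_weight_bounded[OF q b] unfolding \<kappa>_def by metis
  have bound: "\<bar>f s m\<bar> \<le> (A * B * D * E) * (r\<^sup>2 * (\<bar>a\<bar> * \<kappa>)) ^ (s + m)" for s m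
  proof -
    have F: "qfact s q > 0" "qfact m q > 0" "qfact (m + s) q > 0" "qpoch (b\<^sup>2) q s > 0"
      using qfact_pos[OF q] qpoch_pos[OF b2 q_abs[OF q]] by auto
    have "\<bar>f s m\<bar> = \<bar>q\<bar> ^ (s choose 2) * (\<bar>b\<bar> ^ s * \<bar>a\<bar> ^ (s + m)
        / (qfact s q * qfact m q * qpoch (b\<^sup>2) q s)
        * (\<bar>ASC s y z b q\<bar> * (\<bar>qH (m + s) x q\<bar> * \<bar>qH m z q\<bar>)))"
      using F by (simp add: f_def abs_mult power_abs)
    also have "\<dots> \<le> \<bar>b\<bar> ^ s * \<bar>a\<bar> ^ (s + m)
        / (qfact s q * qfact m q * qpoch (b\<^sup>2) q s)
        * (\<bar>ASC s y z b q\<bar> * (\<bar>qH (m + s) x q\<bar> * \<bar>qH m z q\<bar>))"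
      using F q_abs[OF q] by (intro mult_left_le_one_le) (auto intro!: power_le_one)
    also have "\<dots> \<le> \<bar>b\<bar> ^ s * \<bar>a\<bar> ^ (s + m) / (qfact s q * qfact m q * qpoch (b\<^sup>2) q s)
        * ((A * r ^ s * sqrt (qfact s q * qpoch (b\<^sup>2) q s)) *
           ((B * r ^ (m + s) * sqrt (qfact (m + s) q)) * (D * r ^ m * sqrt (qfact m q))))"
      using F r A(1) B(1) D(1) by (intro mult_left_mono mult_mono A B D) auto
    also have "\<dots> = (A * B * D * (r\<^sup>2 * \<bar>a\<bar>) ^ (s + m)) * (\<bar>b\<bar> ^ s *
        (sqrt (qfact s q * qpoch (b\<^sup>2) q s) * sqrt (qfact (m + s) q) * sqrt (qfact m q)
          / (qfact s q * qfact m q * qpoch (b\<^sup>2) q s)))"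
      by (simp add: power_add power_mult_distrib power2_eq_square mult_ac)
    also have "sqrt (qfact s q * qpoch (b\<^sup>2) q s) * sqrt (qfact (m + s) q) * sqrt (qfact m q)
          / (qfact s q * qfact m q * qpoch (b\<^sup>2) q s)
        = sqrt (qfact (s + m) q / (qfact s q * qfact m q) / qpoch (b\<^sup>2) q s)"
      using F by (simp add: real_sqrt_mult real_sqrt_divide add.commute field_simps)
    also have "(A * B * D * (r\<^sup>2 * \<bar>a\<bar>) ^ (s + m)) * (\<bar>b\<bar> ^ s * \<dots>)
        \<le> (A * B * D * (r\<^sup>2 * \<bar>a\<bar>) ^ (s + m)) * (E * \<kappa> ^ (s + m))"
      using A(1) B(1) D(1) r(1) by (intro mult_left_mono E) auto
    finally show ?thesis by (simp add: mult_ac power_mult_distrib)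
  qed
  have row: "f s sums (M * ((-1) ^ s * q ^ (s choose 2) * a ^ s * b ^ s
            / (qfact s q * (qpoch (a\<^sup>2) q s * qpoch (b\<^sup>2) q s))
            * ASC s x z a q * ASC s y z b q))" for s
  proof -
    have "f s = (\<lambda>m. (-1) ^ s * b ^ s * q ^ (s choose 2) * a ^ s / (qfact s q * qpoch (b\<^sup>2) q s)
              * ASC s y z b q * (a ^ m / qfact m q * (qH (m + s) x q * qH m z q)))"
      by (simp add: f_def fun_eq_iff power_add power_minus[of b] mult_ac)
    also have "\<dots> sums ((-1) ^ s * b ^ s * q ^ (s choose 2) * a ^ s / (qfact s q * qpoch (b\<^sup>2) q s)
              * ASC s y z b q * shifted_mehler s x z a q)"
      by (intro sums_mult shifted_mehler_sums q S a)
    finally show ?thesis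
      unfolding shifted_mehler_eq[OF q S(1,3) a, of s] M_def by (simp add: mult_ac)
  qed
  have diag: "(\<Sum>s\<le>n. f s (n - s))
      = a ^ n / (qfact n q * qpoch (b\<^sup>2) q n) * qH n x q * ASC n z y b q" for n
  proof -
    have "(\<Sum>s\<le>n. f s (n - s)) = a ^ n * qH n x q *
        (\<Sum>s\<le>n. (-b) ^ s * q ^ (s choose 2) * ASC s y z b q / (qfact s q * qpoch (b\<^sup>2) q s)
                 * (qH (n - s) z q / qfact (n - s) q))"
      unfolding sum_distrib_left by (rule sum.cong) (auto simp: f_def mult_ac)
    also have "\<dots> = a ^ n * qH n x q * (ASC n z y b q / (qfact n q * qpoch (b\<^sup>2) q n))"
      by (simp only: ASC_inverse_connection[OF q b, of n z y])
    finally show ?thesis by simp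
  qed
  obtain L where L: "(\<lambda>s. M * ((-1) ^ s * q ^ (s choose 2) * a ^ s * b ^ s
            / (qfact s q * (qpoch (a\<^sup>2) q s * qpoch (b\<^sup>2) q s))
            * ASC s x z a q * ASC s y z b q)) sums L"
    "(\<lambda>n. \<Sum>s\<le>n. f s (n - s)) sums L"
    by (rule double_series_rows_diagonals[OF bound _ r(2) row])
       (use \<kappa>(1) in \<open>simp add: less_imp_le\<close>)
  show "summable (\<lambda>k. a ^ k / (qfact k q * qpoch (b\<^sup>2) q k) * qH k x q * ASC k z y b q)"
    using L(2) unfolding diag by (rule sums_summable)
  have "L = (\<Sum>k. a ^ k / (qfact k q * qpoch (b\<^sup>2) q k) * qH k x q * ASC k z y b q)"
    using L(2) unfolding diag by (rule sums_unique)
  moreover have "M \<noteq> 0" unfolding M_def by (rule mehler_closed_form(2)[OF q S(1,3) a])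
  ultimately show "(\<lambda>s. (-1) ^ s * q ^ (s choose 2) * a ^ s * b ^ s
            / (qfact s q * (qpoch (a\<^sup>2) q s * qpoch (b\<^sup>2) q s))
            * ASC s x z a q * ASC s y z b q)
        sums (1 / mehler x z a q
          * (\<Sum>k. a ^ k / (qfact k q * qpoch (b\<^sup>2) q k) * qH k x q * ASC k z y b q))"
    using sums_divide[OF L(1), of M] by (simp add: M_def)
qed


text \<open>
  The map \<open>(i, j, k) \<mapsto> ((i + j, j + k), j)\<close> identifies the index set with the triples \<open>((m, n), j)\<close> with \<open>j \<le> min m n\<close>, and
  the exponents combine to \<open>a\<^sup>m b\<^sup>n\<close> because \<open>\<rho>12 = a b\<close>. The inner sum over \<open>j\<close> is the linearization of
  \<open>H\<^sub>m(z) H\<^sub>n(z)\<close>, after which the double sum factors.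
\<close>

lemma kibble_slepian_triple_series:
  assumes q: "-1 < q" "q < 1" and S: "x \<in> Sq q" "y \<in> Sq q" "z \<in> Sq q"
    and a: "\<bar>a\<bar> < 1" and b: "\<bar>b\<bar> < 1"
  shows "(\<Sum>\<^sub>\<infinity>(i, j, k)\<in>UNIV. (a * b) ^ j * b ^ k * a ^ i
            / (qfact i q * qfact j q * qfact k q)
            * qH (i + j) x q * qH (j + k) y q * qH (i + k) z q)
       = mehler x z a q * mehler z y b q"
proof -
  have q': "q \<le> 1" "\<bar>q\<bar> < 1" using q by auto
  note q1 = q(1) q'(1)
  define F where "F = (\<lambda>(i, j, k). (a * b) ^ j * b ^ k * a ^ i
            / (qfact i q * qfact j q * qfact k q)
            * qH (i + j) x q * qH (j + k) y q * qH (i + k) z q)"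
  define \<theta>0 where "\<theta>0 = max \<bar>a\<bar> \<bar>b\<bar>"
  have \<theta>0: "0 \<le> \<theta>0" "\<theta>0 < 1" "\<bar>a\<bar> \<le> \<theta>0" "\<bar>b\<bar> \<le> \<theta>0" using a b by (auto simp: \<theta>0_def)
  obtain r where r: "r > 1" "r\<^sup>2 * \<theta>0 < 1" using exists_growth_rate[OF \<theta>0(1,2)] by metis
  define \<theta> where "\<theta> = r\<^sup>2 * \<theta>0"
  have \<theta>: "0 \<le> \<theta>" "\<theta> < 1" using r \<theta>0 by (simp_all add: \<theta>_def)
  obtain A where A: "A > 0" "\<And>n. \<bar>qH n x q\<bar> \<le> A * r ^ n * sqrt (qfact n q)"
    using qH_growth[OF q1 S(1) r(1)] by metis
  obtain B where B: "B > 0" "\<And>n. \<bar>qH n y q\<bar> \<le> B * r ^ n * sqrt (qfact n q)"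
    using qH_growth[OF q1 S(2) r(1)] by metis
  obtain D where D: "D > 0" "\<And>n. \<bar>qH n z q\<bar> \<le> D * r ^ n * sqrt (qfact n q)"
    using qH_growth[OF q1 S(3) r(1)] by metis
  obtain E where E: "E > 0" "\<And>s m. qfact (s + m) q / (qfact s q * qfact m q) \<le> E"
    using qbinomial_bounded[OF q'(2)] by metis
  define C where "C = A * B * D * sqrt (E * E * E)"
  have C: "C \<ge> 0" using A B D E by (simp add: C_def)
  have bound: "norm (F p) \<le> (case p of (i, j, k) \<Rightarrow> \<theta> ^ i * (C * \<theta> ^ (j + k)))" for p
  proof -
    obtain i j k where p: "p = (i, j, k)" by (cases p) auto
    have P: "qfact i q > 0" "qfact j q > 0" "qfact k q > 0"
      "qfact (i + j) q > 0" "qfact (j + k) q > 0" "qfact (i + k) q > 0"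
      using qfact_pos[OF q1] by auto
    have ab: "\<bar>a * b\<bar> ^ j * \<bar>b\<bar> ^ k * \<bar>a\<bar> ^ i \<le> \<theta>0 ^ j * \<theta>0 ^ k * \<theta>0 ^ i"
    proof -
      have "\<bar>a * b\<bar> \<le> \<theta>0"
        using mult_left_le[of "\<bar>b\<bar>" "\<bar>a\<bar>"] b \<theta>0 unfolding abs_mult by linarith
      then show ?thesis using \<theta>0 by (intro mult_mono power_mono) auto
    qed
    have "norm (F p) = \<bar>a * b\<bar> ^ j * \<bar>b\<bar> ^ k * \<bar>a\<bar> ^ i / (qfact i q * qfact j q * qfact k q)
        * (\<bar>qH (i + j) x q\<bar> * (\<bar>qH (j + k) y q\<bar> * \<bar>qH (i + k) z q\<bar>))"
      using P by (simp add: F_def p abs_mult power_abs)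
    also have "\<dots> \<le> \<theta>0 ^ j * \<theta>0 ^ k * \<theta>0 ^ i / (qfact i q * qfact j q * qfact k q)
        * ((A * r ^ (i + j) * sqrt (qfact (i + j) q)) * ((B * r ^ (j + k) * sqrt (qfact (j + k) q))
            * (D * r ^ (i + k) * sqrt (qfact (i + k) q))))"
      using P r A(1) B(1) D(1) \<theta>0
      by (intro mult_mono divide_right_mono A B D ab) auto
    also have "\<dots> = A * B * D * (\<theta> ^ i * \<theta> ^ (j + k)) *
        (sqrt (qfact (i + j) q) * sqrt (qfact (j + k) q) * sqrt (qfact (i + k) q)
          / (qfact i q * qfact j q * qfact k q))"
      by (simp add: \<theta>_def power_add power_mult_distrib power2_eq_square mult_ac)
    also have "sqrt (qfact (i + j) q) * sqrt (qfact (j + k) q) * sqrt (qfact (i + k) q)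
          / (qfact i q * qfact j q * qfact k q)
        = sqrt ((qfact (i + j) q / (qfact i q * qfact j q)) * (qfact (j + k) q / (qfact j q * qfact k q))
             * (qfact (i + k) q / (qfact i q * qfact k q)))"
      using P by (simp add: real_sqrt_mult real_sqrt_divide field_simps)
    also have "\<dots> \<le> sqrt (E * E * E)"
      using P E(1) by (intro real_sqrt_le_mono mult_mono E(2)) auto
    also have "A * B * D * (\<theta> ^ i * \<theta> ^ (j + k)) * sqrt (E * E * E) = \<theta> ^ i * (C * \<theta> ^ (j + k))"
      by (simp add: C_def)
    finally show ?thesis using A(1) B(1) D(1) \<theta> by (simp add: p mult_left_mono)
  qed
  have "F summable_on UNIV"
  proof (rule abs_summable_summable, rule Infinite_Sum.abs_summable_on_comparison_test'[OF _ bound])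
    have 1: "((\<lambda>(j, k). c * (C * \<theta> ^ (j + k))) has_sum (c * (C / (1 - \<theta>) / (1 - \<theta>)))) UNIV" for c
      using has_sum_cmult_right[OF summable_geometric_pair[OF C \<theta>], of c]
      by (simp add: case_prod_unfold)
    have "(\<lambda>i. \<theta> ^ i) sums (1 / (1 - \<theta>))" using \<theta> by (intro geometric_sums) auto
    then have "((\<lambda>i. \<theta> ^ i) has_sum (1 / (1 - \<theta>))) UNIV"
      using \<theta> by (intro norm_summable_imp_has_sum) (auto simp: summable_geometric)
    from has_sum_cmult_left[OF this, THEN has_sum_imp_summable]
    have "(\<lambda>i. \<theta> ^ i * (C / (1 - \<theta>) / (1 - \<theta>))) summable_on UNIV" .
    then have "(\<lambda>(i, j, k). \<theta> ^ i * (C * \<theta> ^ (j + k))) summable_on (UNIV \<times> UNIV)"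
      by (rule summable_on_SigmaI[rotated]) (use 1 C \<theta> in auto)
    then show "(\<lambda>(i, j, k). \<theta> ^ i * (C * \<theta> ^ (j + k))) summable_on UNIV" by simp
  qed
  then obtain L where L: "(F has_sum L) UNIV" by (auto simp: summable_on_def)
  define G where "G = (\<lambda>((m, n), j). a ^ m * b ^ n * qH m x q * qH n y q *
      (qH ((m - j) + (n - j)) z q / (qfact j q * qfact (m - j) q * qfact (n - j) q)))"
  have "(G has_sum L) (Sigma (UNIV \<times> UNIV) (\<lambda>(m, n). {..min m n}))"
    using L
    by (subst has_sum_reindex_bij_witness[where T = UNIV and h = F and s' = L and
          i = "\<lambda>(i, j, k). ((i + j, j + k), j)" and j = "\<lambda>((m, n), j). (m - j, j, n - j)"])
       (auto simp: F_def G_def power_mult_distrib mult_ac simp flip: power_add)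
  then have "((\<lambda>(m, n). a ^ m * b ^ n * qH m x q * qH n y q
        * (qH m z q / qfact m q * (qH n z q / qfact n q))) has_sum L) (UNIV \<times> UNIV)"
  proof (rule has_sum_SigmaD)
    fix p :: "nat \<times> nat"
    obtain m n where p: "p = (m, n)" by (cases p)
    have "(\<Sum>j\<le>min m n. G ((m, n), j))
        = a ^ m * b ^ n * qH m x q * qH n y q * (qH m z q / qfact m q * (qH n z q / qfact n q))"
      unfolding qH_linearization[OF q1] G_def by (simp add: sum_distrib_left)
    then show "((\<lambda>j. G (p, j)) has_sum (case p of (m, n) \<Rightarrow> a ^ m * b ^ n * qH m x q * qH n y q
        * (qH m z q / qfact m q * (qH n z q / qfact n q)))) (case p of (m, n) \<Rightarrow> {..min m n})"
      unfolding p by (auto intro!: has_sum_finiteI)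
  qed
  then have gh: "((\<lambda>(m, n). (a ^ m / qfact m q * (qH (m + 0) x q * qH m z q)) *
        (b ^ n / qfact n q * (qH (n + 0) z q * qH n y q))) has_sum L) (UNIV \<times> UNIV)"
    by (simp add: mult_ac case_prod_unfold)
  note sa = shifted_mehler_sums[OF q1 S(1,3) a, of 0]
  note sb = shifted_mehler_sums[OF q1 S(3,2) b, of 0]
  have "((\<lambda>n. (a ^ m / qfact m q * (qH (m + 0) x q * qH m z q)) *
        (b ^ n / qfact n q * (qH (n + 0) z q * qH n y q))) has_sum
        ((a ^ m / qfact m q * (qH (m + 0) x q * qH m z q)) * mehler z y b q)) UNIV" (is "(?row has_sum ?T) _") for m
  proof -
    have "?row summable_on UNIV"
      using summable_on_SigmaD1[OF has_sum_imp_summable[OF gh], of m] by simp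
    moreover have "?row sums ?T" by (rule sums_mult[OF sb])
    ultimately show ?thesis by (rule summable_on_sums_imp_has_sum)
  qed
  then have "((\<lambda>m. (a ^ m / qfact m q * (qH (m + 0) x q * qH m z q)) * mehler z y b q) has_sum L) UNIV"
    using has_sum_SigmaD[OF gh] by simp
  then have "L = mehler x z a q * mehler z y b q"
    using sums_mult2[OF sa] by (rule sums_unique2[OF has_sum_imp_sums])
  then show ?thesis using infsumI[OF L] by (simp add: F_def)
qed

text \<open>
  If the correlation of the first two coordinates is the product of the other two, they are conditionally independent given the third.
  The precision matrix \<open>Q\<close> then has a zero in position \<open>(1, 2)\<close>, and the quadratic form is
  \<open>(x - a z)\<^sup>2 / (1 - a\<^sup>2) + (z - b y)\<^sup>2 / (1 - b\<^sup>2) + y\<^sup>2\<close>.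
\<close>

lemma gauss3_density_markov:
  assumes a: "\<bar>a\<bar> < 1" and b: "\<bar>b\<bar> < 1"
  shows "gauss3_density (corr_mat (a * b) a b) (vector [x, y, z])
    = normal_density (a * z) (sqrt (1 - a\<^sup>2)) x * normal_density (b * y) (sqrt (1 - b\<^sup>2)) z
        * std_normal_density y"
proof -
  define A where "A = 1 - a\<^sup>2"
  define B where "B = 1 - b\<^sup>2"
  have A: "A > 0" and B: "B > 0" using a b by (simp_all add: A_def B_def abs_square_less_1)
  have a2: "a * a = 1 - A" and b2: "b * b = 1 - B" by (simp_all add: A_def B_def power2_eq_square)
  define R where "R = corr_mat (a * b) a b"
  define Q :: "real^3^3" where "Q = vector [vector [1 / A, 0, - a / A],
      vector [0, 1 / B, - b / B], vector [- a / A, - b / B, a\<^sup>2 / A + 1 / B]]"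
  have QR: "Q ** R = mat 1"
    using A B unfolding R_def Q_def corr_mat_def
    by (simp add: vec_eq_iff forall_3 matrix_matrix_mult_def sum_3 mat_def)
       (simp add: divide_simps, simp add: A_def B_def algebra_simps power2_eq_square)
  then have "R ** Q = mat 1 \<and> Q ** R = mat 1" by (simp add: matrix_left_right_inverse)
  then have "R ** matrix_inv R = mat 1 \<and> matrix_inv R ** R = mat 1"
    unfolding matrix_inv_def by (rule someI)
  then have "Q = Q ** (R ** matrix_inv R)" by (simp only: matrix_mul_rid)
  also have "\<dots> = (Q ** R) ** matrix_inv R" by (rule matrix_mul_assoc)
  also have "\<dots> = matrix_inv R" unfolding QR by (rule matrix_mul_lid)
  finally have "Q = matrix_inv R" .
  moreover have "vector [x, y, z] \<bullet> (Q *v vector [x, y, z])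
      = (x - a * z)\<^sup>2 / A + (z - b * y)\<^sup>2 / B + y\<^sup>2"
    unfolding Q_def inner_vec_def matrix_vector_mult_def using A B
    by (simp add: sum_3)
       (simp add: divide_simps, simp add: A_def B_def algebra_simps power2_eq_square)
  moreover have "det R = A * B"
    unfolding R_def corr_mat_def A_def B_def
    by (simp add: det_3) (simp add: algebra_simps power2_eq_square)
  ultimately have "gauss3_density R (vector [x, y, z])
      = exp (- ((x - a * z)\<^sup>2 / A + (z - b * y)\<^sup>2 / B + y\<^sup>2) / 2) / sqrt ((2 * pi) ^ 3 * (A * B))"
    unfolding gauss3_density_def by simp
  also have "- ((x - a * z)\<^sup>2 / A + (z - b * y)\<^sup>2 / B + y\<^sup>2) / 2
      = - (x - a * z)\<^sup>2 / (2 * A) + - (z - b * y)\<^sup>2 / (2 * B) + - y\<^sup>2 / 2"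
    by (simp add: diff_divide_distrib add_divide_distrib)
  also have "sqrt ((2 * pi) ^ 3 * (A * B)) = sqrt (2 * pi * A) * sqrt (2 * pi * B) * sqrt (2 * pi)"
    by (simp add: power3_eq_cube mult_ac flip: real_sqrt_mult)
  finally show ?thesis
    unfolding R_def exp_add normal_density_def A_def[symmetric] B_def[symmetric] using A B by simp
qed

theorem corollary3:
  fixes q \<rho>12 \<rho>13 \<rho>23 x1 x2 x3 :: real
  assumes "-1 < q" "q \<le> 1"
    and "\<rho>12 \<in> {-1<..<1}" "\<rho>13 \<in> {-1<..<1}" "\<rho>23 \<in> {-1<..<1}"
    and "1 + 2 * \<rho>12 * \<rho>13 * \<rho>23 - \<rho>12\<^sup>2 - \<rho>13\<^sup>2 - \<rho>23\<^sup>2 \<ge> 0"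
    and "x1 \<in> Sq q" "x2 \<in> Sq q" "x3 \<in> Sq q"
  shows "(\<rho>12 = \<rho>13 * \<rho>23 \<longrightarrow>
      f_3D x1 x2 x3 (\<rho>13 * \<rho>23) \<rho>13 \<rho>23 q
        = f_CN x1 x3 \<rho>13 q * f_CN x3 x2 \<rho>23 q * f_N x2 q
    \<and> (\<lambda>s. \<rho>13 ^ s / (qfact s q * qpoch (\<rho>13\<^sup>2 * \<rho>23\<^sup>2) q s)
            * ASC s x1 x2 (\<rho>13 * \<rho>23) q * ASC s x3 x2 \<rho>23 q)
        sums f_CN_ratio x1 x3 \<rho>13 x2 (\<rho>13 * \<rho>23) q)
  \<and> (\<rho>12 = 0 \<longrightarrow>
      (q = 1 \<longrightarrow> 1 + 2 * \<rho>12 * \<rho>13 * \<rho>23 - \<rho>12\<^sup>2 - \<rho>13\<^sup>2 - \<rho>23\<^sup>2 > 0) \<longrightarrow>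
      summable (\<lambda>k. \<rho>13 ^ k / (qfact k q * qpoch (\<rho>23\<^sup>2) q k)
            * qH k x1 q * ASC k x3 x2 \<rho>23 q)
    \<and> (\<lambda>s. (-1) ^ s * q ^ (s choose 2) * \<rho>13 ^ s * \<rho>23 ^ s
            / (qfact s q * (qpoch (\<rho>13\<^sup>2) q s * qpoch (\<rho>23\<^sup>2) q s))
            * ASC s x1 x3 \<rho>13 q * ASC s x2 x3 \<rho>23 q)
        sums (f_N_over_f_CN x1 x3 \<rho>13 q
          * (\<Sum>k. \<rho>13 ^ k / (qfact k q * qpoch (\<rho>23\<^sup>2) q k)
                * qH k x1 q * ASC k x3 x2 \<rho>23 q)))"
proof -
  note q = assms(1,2) and S = assms(7-9)
  have a: "\<bar>\<rho>13\<bar> < 1" and b: "\<bar>\<rho>23\<bar> < 1" using assms(4,5) by auto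
  have ab: "\<bar>\<rho>13 * \<rho>23\<bar> < 1"
    using mult_left_le[of "\<bar>\<rho>23\<bar>" "\<bar>\<rho>13\<bar>"] a b unfolding abs_mult by linarith
  note M13 = mehler_closed_form(1)[OF q S(1,3) a]
  have i: "f_3D x1 x2 x3 (\<rho>13 * \<rho>23) \<rho>13 \<rho>23 q
        = f_CN x1 x3 \<rho>13 q * f_CN x3 x2 \<rho>23 q * f_N x2 q"
  proof (cases "q = 1")
    case True
    then show ?thesis by (simp add: f_3D_def f_CN_def f_N_def gauss3_density_markov[OF a b])
  next
    case False
    then have "q < 1" using q by simp
    from kibble_slepian_triple_series[OF q(1) this S a b] False show ?thesis
      by (simp add: f_3D_def f_CN_eq M13 mehler_closed_form(1)[OF q S(3,2) b] mult_ac)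
  qed
  have ii: "(\<lambda>s. \<rho>13 ^ s / (qfact s q * qpoch (\<rho>13\<^sup>2 * \<rho>23\<^sup>2) q s)
            * ASC s x1 x2 (\<rho>13 * \<rho>23) q * ASC s x3 x2 \<rho>23 q)
        sums f_CN_ratio x1 x3 \<rho>13 x2 (\<rho>13 * \<rho>23) q"
    using density_ratio_expansion[OF q S a b]
    by (simp only: f_CN_ratio_def M13 mehler_closed_form(1)[OF q S(1,2) ab] power_mult_distrib)
  have iii: "summable (\<lambda>k. \<rho>13 ^ k / (qfact k q * qpoch (\<rho>23\<^sup>2) q k)
            * qH k x1 q * ASC k x3 x2 \<rho>23 q)
    \<and> (\<lambda>s. (-1) ^ s * q ^ (s choose 2) * \<rho>13 ^ s * \<rho>23 ^ s
            / (qfact s q * (qpoch (\<rho>13\<^sup>2) q s * qpoch (\<rho>23\<^sup>2) q s))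
            * ASC s x1 x3 \<rho>13 q * ASC s x2 x3 \<rho>23 q)
        sums (f_N_over_f_CN x1 x3 \<rho>13 q
          * (\<Sum>k. \<rho>13 ^ k / (qfact k q * qpoch (\<rho>23\<^sup>2) q k)
                * qH k x1 q * ASC k x3 x2 \<rho>23 q))"
    if "\<rho>12 = 0" "q = 1 \<longrightarrow> 1 + 2 * \<rho>12 * \<rho>13 * \<rho>23 - \<rho>12\<^sup>2 - \<rho>13\<^sup>2 - \<rho>23\<^sup>2 > 0"
  proof -
    have "\<rho>13\<^sup>2 + \<rho>23\<^sup>2 < 1" if "q = 1"
      using \<open>\<rho>12 = 0\<close> \<open>q = 1 \<longrightarrow> _\<close> that by simp
    from inverse_density_ratio_expansion[OF q S a b this] show ?thesis
      by (simp only: f_N_over_f_CN_def M13)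
  qed
  show ?thesis using i ii iii by blast
qed

end
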